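(* Let $k\geq 2$ be an integer and let $G$ be a $2$-connected graph of order $n\geq 4$ with minimum degree $\delta(G)\geq k$. Then $cc_{k}(G)=k$.
   Context: All graphs are finite, simple and undirected. An edge-coloring (not necessarily proper) of a graph is $k$-color connecting if between every pair of distinct vertices there is a path whose edges use at least $k$ different colors. $cc_{k}(G)$ is the minimum number of colors of a $k$-color connecting edge-coloring of $G$. *)

theory Defs
  imports "Graph_Theory.Graph_Theory" "HOL-Library.Extended_Nat"
begin

text \<open>
  A finite simple undirected graph is a \<^locale>\<open>pair_graph\<close>: a finite, loop-free, symmetric digraph
  without parallel arcs, where the edge joining \<open>u\<close> and \<open>v\<close> is the pair of arcs
  \<open>(u, v)\<close>, \<open>(v, u)\<close>. Undirected edges are recovered as two-element sets, so that an edge-coloring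
  gives both arcs of an edge the same color.
\<close>

definition uedges :: "'a pair_pre_digraph \<Rightarrow> 'a set set" where
  "uedges G = {{u, v} | u v. (u, v) \<in> parcs G}"

text \<open>By symmetry the out-degree is the degree of the undirected graph.\<close>

definition min_degree :: "'a pair_pre_digraph \<Rightarrow> nat" where
  "min_degree G = Min (out_degree (with_proj G) ` pverts G)"

definition vertex_connected :: "nat \<Rightarrow> 'a pair_pre_digraph \<Rightarrow> bool" where
  "vertex_connected l G \<longleftrightarrow> l < card (pverts G) \<and>
     (\<forall>S \<subseteq> pverts G. card S < l \<longrightarrow> connected (with_proj G \<restriction> (pverts G - S)))"

text \<open>
  Only the values of a coloring on \<^term>\<open>uedges G\<close> are relevant. A \<^const>\<open>vpath\<close> is a nonempty list of
  pairwise distinct, consecutively adjacent vertices.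
\<close>

definition path_colors :: "('a set \<Rightarrow> nat) \<Rightarrow> 'a list \<Rightarrow> nat set" where
  "path_colors c p = (\<lambda>(x, y). c {x, y}) ` set (vwalk_arcs p)"

definition color_connecting :: "nat \<Rightarrow> 'a pair_pre_digraph \<Rightarrow> ('a set \<Rightarrow> nat) \<Rightarrow> bool" where
  "color_connecting k G c \<longleftrightarrow>
     (\<forall>u \<in> pverts G. \<forall>v \<in> pverts G. u \<noteq> v \<longrightarrow>
        (\<exists>p. vpath p (with_proj G) \<and> hd p = u \<and> last p = v \<and> k \<le> card (path_colors c p)))"

text \<open>
  The value is \<open>\<infinity>\<close> if there is no \<open>k\<close>-color connecting edge-coloring; otherwise the infimum is a
  minimum.
\<close>

definition cc :: "nat \<Rightarrow> 'a pair_pre_digraph \<Rightarrow> enat" where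
  "cc k G = (INF c \<in> {c. color_connecting k G c}. enat (card (c ` uedges G)))"

end

theory Submission
  imports Defs
begin

text \<open>
  Call a path full if it uses all colors from \<open>{..<k}\<close>. By a linking argument it suffices to color a
  subgraph \<open>B\<close> so that every vertex of \<open>B\<close> is joined to a root \<open>b\<close> by a full path inside \<open>B\<close>: if
  \<open>u\<close> can reach \<open>b\<close> without meeting the rest of \<open>B\<close>, then biconnectedness yields disjoint paths from
  \<open>u\<close> and any other \<open>v\<close> to \<open>B\<close>, one of which ends in \<open>b\<close>.

  Three subgraphs have suitable colorings: a cycle of length at least \<open>2 k\<close>; a cycle together with an
  outside vertex that has \<open>k\<close> neighbors on it (a spoke gets the color of the rim edge that enters its
  end in a fixed orientation); and a path whose first vertex has \<open>k\<close> neighbors on it, the root being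
  the last of these.

  Let \<open>P\<close> be a longest path; all neighbors of its ends lie on \<open>P\<close>. If no neighbor of the last vertex
  precedes a neighbor of the first one, the two ends of \<open>P\<close> give two almost disjoint colored fans, and
  every vertex reaches one of the two roots while avoiding the rest of its fan. Otherwise a crossing
  of minimal width gives a cycle of length at least \<open>2 k\<close> (Dirac's count), or a Hamiltonian cycle. In the latter case with
  \<open>n < 2 k\<close>, Dirac's count again gives a cycle through all vertices but one, whose neighbors all lie
  on that cycle.
\<close>

section \<open>Paths and linking\<close>

fun ledges :: "'a list \<Rightarrow> 'a set set" where
  "ledges (x # y # xs) = insert {x, y} (ledges (y # xs))"
| "ledges _ = {}"

lemma ledges_Cons: "q \<noteq> [] \<Longrightarrow> ledges (x # q) = insert {x, hd q} (ledges q)"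
  by (cases q) auto

lemma ledges_snoc: "q \<noteq> [] \<Longrightarrow> ledges (q @ [x]) = insert {last q, x} (ledges q)"
  by (induction q rule: ledges.induct) auto

lemma ledges_rev [simp]: "ledges (rev p) = ledges p"
proof (induction p)
  case (Cons x p)
  then show ?case by (cases "p = []") (simp_all add: ledges_snoc ledges_Cons last_rev insert_commute)
qed simp

lemma ledges_append:
  "p \<noteq> [] \<Longrightarrow> q \<noteq> [] \<Longrightarrow> ledges (p @ q) = insert {last p, hd q} (ledges p \<union> ledges q)"
proof (induction p)
  case (Cons x p)
  then show ?case by (cases "p = []") (auto simp: ledges_Cons)
qed simp

lemma ledges_append_subset: "ledges p \<union> ledges q \<subseteq> ledges (p @ q)"
  by (cases "p = []"; cases "q = []") (auto simp: ledges_append)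

lemma finite_ledges [simp]: "finite (ledges p)"
  by (induction p rule: ledges.induct) auto

lemma path_colors_ledges: "path_colors c p = c ` ledges p"
  unfolding path_colors_def by (induction p rule: ledges.induct) auto

lemma vwalk_arcs_successively: "set (vwalk_arcs p) \<subseteq> E \<longleftrightarrow> successively (\<lambda>x y. (x, y) \<in> E) p"
  by (induction p rule: vwalk_arcs.induct) auto

text \<open>The paths built from cycles and fans consist of stretches of an indexed sequence, so
  finding a color on them amounts to finding an index.\<close>

lemma ledges_map_interval:
  "ledges (map v [i..<Suc j]) = {{v t, v (Suc t)} | t. i \<le> t \<and> t < j}"
proof (induction j)
  case (Suc j)
  show ?case
  proof (cases "i \<le> j")
    case True
    then have "map v [i..<Suc (Suc j)] = map v [i..<Suc j] @ [v (Suc j)]" by simp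
    moreover have "map v [i..<Suc j] \<noteq> []" "last (map v [i..<Suc j]) = v j" using True by auto
    ultimately have "ledges (map v [i..<Suc (Suc j)]) = insert {v j, v (Suc j)} (ledges (map v [i..<Suc j]))"
      using ledges_snoc by metis
    then show ?thesis using True Suc.IH by (auto simp: less_Suc_eq)
  qed auto
qed auto

section \<open>Paths and reachability in a simple graph\<close>

locale simple_graph =
  fixes V :: "'a set" and adj :: "'a \<Rightarrow> 'a \<Rightarrow> bool"
  assumes finite_V: "finite V"
    and adj_sym: "adj x y \<Longrightarrow> adj y x"
    and adj_irrefl: "\<not> adj x x"
    and adj_V: "adj x y \<Longrightarrow> x \<in> V"
begin

definition is_path :: "'a list \<Rightarrow> bool" where
  "is_path p \<longleftrightarrow> p \<noteq> [] \<and> set p \<subseteq> V \<and> distinct p \<and> successively adj p"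

text \<open>\<open>X\<close> may be any set, so that avoiding a vertex \<open>w\<close> is expressed
  by the complement \<open>- {w}\<close>, and meeting \<open>B\<close> only in \<open>b\<close> by
  \<open>- (B - {b})\<close>.\<close>

definition joined :: "'a set \<Rightarrow> 'a \<Rightarrow> 'a \<Rightarrow> bool" where
  "joined X x y \<longleftrightarrow> (\<exists>p. is_path p \<and> set p \<subseteq> X \<and> hd p = x \<and> last p = y)"

definition full_joined :: "nat \<Rightarrow> ('a set \<Rightarrow> nat) \<Rightarrow> 'a set \<Rightarrow> 'a \<Rightarrow> 'a \<Rightarrow> bool" where
  "full_joined k c X x y \<longleftrightarrow>
     (\<exists>p. is_path p \<and> set p \<subseteq> X \<and> hd p = x \<and> last p = y \<and> {..<k} \<subseteq> c ` ledges p)"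

lemma adj_sym_iff: "adj x y \<longleftrightarrow> adj y x"
  using adj_sym by blast

lemma is_path_rev [simp]: "is_path (rev p) \<longleftrightarrow> is_path p"
  unfolding is_path_def by (simp add: adj_sym_iff)

lemma is_path_Cons: "q \<noteq> [] \<Longrightarrow> is_path (x # q) \<longleftrightarrow> adj x (hd q) \<and> x \<notin> set q \<and> is_path q"
  using adj_V by (auto simp: is_path_def successively_Cons)

lemma is_path_append:
  assumes "p \<noteq> []" "q \<noteq> []"
  shows "is_path (p @ q) \<longleftrightarrow> is_path p \<and> is_path q \<and> set p \<inter> set q = {} \<and> adj (last p) (hd q)"
  using assms by (auto simp: is_path_def successively_append_iff)

text \<open>Serves in both directions: to cut a path at \<open>x\<close>, and to glue two paths that
  share only \<open>x\<close>.\<close>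

lemma is_path_split: "is_path (p @ x # q) \<longleftrightarrow> is_path (p @ [x]) \<and> is_path (x # q) \<and> set p \<inter> set q = {}"
  by (auto simp: is_path_def successively_append_iff successively_Cons)

lemma full_joined_sym: "full_joined k c X x y \<Longrightarrow> full_joined k c X y x"
proof -
  assume "full_joined k c X x y"
  then obtain p where "is_path p" "set p \<subseteq> X" "hd p = x" "last p = y" "{..<k} \<subseteq> c ` ledges p"
    unfolding full_joined_def by blast
  then show ?thesis unfolding full_joined_def
    by (intro exI[of _ "rev p"]) (auto simp: hd_rev last_rev)
qed

lemma joined_refl: "x \<in> X \<Longrightarrow> x \<in> V \<Longrightarrow> joined X x x"
  unfolding joined_def by (intro exI[of _ "[x]"]) (auto simp: is_path_def)

lemma joined_mono: "joined X x y \<Longrightarrow> X \<subseteq> Y \<Longrightarrow> joined Y x y"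
  unfolding joined_def by blast

lemma joined_sym: "joined X x y \<Longrightarrow> joined X y x"
proof -
  assume "joined X x y"
  then obtain p where "is_path p" "set p \<subseteq> X" "hd p = x" "last p = y"
    unfolding joined_def by blast
  then show ?thesis unfolding joined_def
    by (intro exI[of _ "rev p"]) (auto simp: hd_rev last_rev)
qed

text \<open>If \<open>x\<close> already lies on the path from \<open>y\<close>, the tail that starts
  at \<open>x\<close> serves; otherwise \<open>x\<close> is put in front. Iterating this replaces
  the extraction of a path from a walk.\<close>

lemma joined_step:
  assumes "adj x y" "joined X y z" "x \<in> X" shows "joined X x z"
proof -
  obtain p where p: "is_path p" "set p \<subseteq> X" "hd p = y" "last p = z"
    using assms unfolding joined_def by blast
  show ?thesis
  proof (cases "x \<in> set p")
    case True
    then obtain p1 p2 where "p = p1 @ x # p2" by (meson split_list)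
    then have "is_path (x # p2)" using p(1) is_path_split by blast
    then show ?thesis unfolding joined_def using p(2,4) \<open>p = p1 @ x # p2\<close>
      by (intro exI[of _ "x # p2"]) auto
  next
    case False
    moreover have "p \<noteq> []" using p by (simp add: is_path_def)
    ultimately show ?thesis unfolding joined_def using p assms
      by (intro exI[of _ "x # p"]) (auto simp: is_path_Cons)
  qed
qed

lemma joined_trans:
  assumes "joined X x y" "joined X y z" shows "joined X x z"
proof -
  obtain p where p: "is_path p" "set p \<subseteq> X" "hd p = x" "last p = y"
    using assms unfolding joined_def by blast
  then show ?thesis
  proof (induction p arbitrary: x)
    case Nil
    then show ?case by (simp add: is_path_def)
  next
    case (Cons a p)
    show ?case
    proof (cases "p = []")
      case True
      then show ?thesis using Cons assms by auto
    next
      case False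
      then show ?thesis using Cons joined_step[of a "hd p" X z] by (auto simp: is_path_Cons)
    qed
  qed
qed

text \<open>The path is cut off at its first vertex in \<open>X\<close>, which becomes
  \<open>b\<close>.\<close>

lemma joined_first_hit:
  assumes "joined V u x" "x \<in> X"
  obtains b where "b \<in> X" "joined (- (X - {b})) u b"
proof -
  obtain r where r: "is_path r" "hd r = u" "last r = x"
    using assms unfolding joined_def by blast
  have "x \<in> set r" using r by (auto simp: is_path_def)
  then obtain r1 b r2 where b: "r = r1 @ b # r2" "b \<in> X" "\<forall>t\<in>set r1. t \<notin> X"
    using split_list_first_prop[of r "\<lambda>t. t \<in> X"] assms by blast
  have "is_path (r1 @ [b])" using r b is_path_split by blast
  moreover have "hd (r1 @ [b]) = u" using r b by (cases r1) auto
  ultimately have "joined (- (X - {b})) u b" unfolding joined_def using b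
    by (intro exI[of _ "r1 @ [b]"]) auto
  then show ?thesis using that b by blast
qed

lemma is_path_interval:
  assumes "i \<le> j" "inj_on v {i..j}" "\<And>t. i \<le> t \<Longrightarrow> t < j \<Longrightarrow> adj (v t) (v (Suc t))" "v ` {i..j} \<subseteq> V"
  shows "is_path (map v [i..<Suc j])"
proof -
  have "successively adj (map v [i..<Suc j])"
    unfolding successively_conv_nth
  proof (intro allI impI)
    fix t assume "Suc t < length (map v [i..<Suc j])"
    then show "adj (map v [i..<Suc j] ! t) (map v [i..<Suc j] ! Suc t)"
      using assms(3)[of "i + t"] by (simp del: upt_Suc)
  qed
  moreover have "set (map v [i..<Suc j]) = v ` {i..j}" using assms(1) by (auto simp del: upt_Suc simp: atLeastLessThanSuc_atLeastAtMost)
  moreover have "distinct (map v [i..<Suc j])" using assms(2) by (simp del: upt_Suc add: distinct_map atLeastLessThanSuc_atLeastAtMost)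
  ultimately show ?thesis using assms unfolding is_path_def by auto
qed

end

section \<open>Linking in biconnected graphs\<close>

locale biconnected_graph = simple_graph +
  assumes avoid: "w \<in> V \<Longrightarrow> x \<in> V - {w} \<Longrightarrow> y \<in> V - {w} \<Longrightarrow> joined (- {w}) x y"
    and card_V: "3 \<le> card V"
begin

text \<open>With at least three vertices there is a third one to delete, and \<open>avoid\<close>
  applies to it.\<close>

lemma connected_V:
  assumes "x \<in> V" "y \<in> V" shows "joined V x y"
proof -
  have "\<not> V \<subseteq> {x, y}"
    using card_V card_mono[of "{x, y}" V] card_insert_le_m1[of 2 "{y}" x] by (auto simp: card_insert_if split: if_splits)
  then obtain w where "w \<in> V" "w \<noteq> x" "w \<noteq> y" by blast
  then have "joined (- {w}) x y" using avoid[of w x y] assms by blast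
  then show ?thesis unfolding joined_def is_path_def by blast
qed

text \<open>Induction along \<open>r\<close> towards \<open>b\<close>: enlarge \<open>B\<close> by the predecessor of \<open>b\<close>. If both resulting paths already
  use up \<open>b\<close> and its predecessor, one of them is rerouted to \<open>B - {b}\<close> by a path that avoids \<open>b\<close>.\<close>

lemma linking:
  assumes "B \<subseteq> V" "b \<in> B" "B \<noteq> {b}" "is_path r" "hd r = u" "last r = b" "set r \<inter> B = {b}"
    and "v \<in> V" "v \<noteq> u"
  shows "\<exists>p q. is_path p \<and> is_path q \<and> set p \<inter> set q = {} \<and> {hd p, hd q} = {u, v} \<and>
    last p = b \<and> set p \<inter> B = {b} \<and> last q \<in> B - {b} \<and> set q \<inter> B = {last q}"
  using assms
proof (induction r arbitrary: B b rule: rev_induct)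
  case Nil
  then show ?case by (simp add: is_path_def)
next
  case (snoc b0 r')
  then have [simp]: "b0 = b" by simp
  have bV: "b \<in> V" using snoc by blast
  obtain y where y: "y \<in> B" "y \<noteq> b" using snoc.prems(2,3) by blast
  have yV: "y \<in> V" using y snoc.prems by blast
  show ?case
  proof (cases "r' = []")
    case True
    \<comment> \<open>The trivial path \<open>[b]\<close> takes care of \<open>u\<close>; the other
      path runs from \<open>v\<close>, avoiding \<open>b\<close>, up to its first vertex in
      \<open>B\<close>.\<close>
    then have ub: "u = b" using snoc by simp
    obtain s where s: "is_path s" "set s \<subseteq> - {b}" "hd s = v" "last s = y"
      using avoid[of b v y] bV yV y ub snoc.prems unfolding joined_def by blast
    have "y \<in> set s" using s by (auto simp: is_path_def)
    then obtain s1 z s2 where z: "s = s1 @ z # s2" "z \<in> B" "\<forall>t\<in>set s1. t \<notin> B"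
      using split_list_first_prop[of s "\<lambda>t. t \<in> B"] y by blast
    have "is_path (s1 @ [z])" using s z is_path_split by blast
    moreover have "hd (s1 @ [z]) = v" using s z by (cases s1) auto
    moreover have "is_path [b]" using bV by (simp add: is_path_def)
    ultimately show ?thesis using z s ub snoc.prems(2)
      by (intro exI[of _ "[b]"] exI[of _ "s1 @ [z]"]) auto
  next
    case False
    define b' where "b' = last r'"
    have r': "is_path r'" "adj b' b" "b \<notin> set r'"
      using snoc.prems(4) False by (auto simp: is_path_append b'_def)
    have b': "b' \<in> set r'" using False by (simp add: b'_def)
    have b'B: "b' \<notin> B" "b' \<in> V" using b' r' snoc.prems(7) by (auto simp: is_path_def)
    have "\<exists>p q. is_path p \<and> is_path q \<and> set p \<inter> set q = {} \<and> {hd p, hd q} = {u, v} \<and>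
      last p = b' \<and> set p \<inter> insert b' B = {b'} \<and> last q \<in> insert b' B - {b'} \<and> set q \<inter> insert b' B = {last q}"
    proof (rule snoc.IH)
      show "hd r' = u" using snoc.prems(5) False by simp
      show "set r' \<inter> insert b' B = {b'}" using b' snoc.prems(7) r' by auto
    qed (use snoc.prems b'B r' b'_def in auto)
    then obtain p q where pq: "is_path p" "is_path q" "set p \<inter> set q = {}" "{hd p, hd q} = {u, v}"
      "last p = b'" "set p \<inter> insert b' B = {b'}" "last q \<in> insert b' B - {b'}" "set q \<inter> insert b' B = {last q}"
      by (elim exE conjE) (rule that)
    have pB: "set p \<inter> B = {}" using pq(6) b'B(1) by auto
    have qB': "set q \<inter> B = {last q}" and qB: "\<And>t. t \<in> set q \<Longrightarrow> t \<in> B \<Longrightarrow> t = last q" "last q \<in> B"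
      using pq(7,8) by auto
    have ne: "p \<noteq> []" "q \<noteq> []" using pq(1,2) by (auto simp: is_path_def)
    have pb: "is_path (p @ [b])" "hd (p @ [b]) = hd p"
      using ne pq(1,5) pB r'(2) snoc.prems(2) bV by (auto simp: is_path_append is_path_def[of "[b]"])
    show ?thesis
    proof (cases "last q = b")
      \<comment> \<open>The second path misses \<open>b\<close>, so the first one can simply be
        prolonged from \<open>b'\<close> to \<open>b\<close>.\<close>
      case False
      moreover have "b \<notin> set q" using False qB(1) snoc.prems(2) by metis
      ultimately show ?thesis using pq(2-4) pb pB qB' qB(2) snoc.prems(2)
        by (intro exI[of _ "p @ [b]"] exI[of _ q]) auto
    next
      case True
      \<comment> \<open>The detour leaves \<open>p\<close> and \<open>q\<close> for the last time at
        \<open>x\<close> and then first meets \<open>B\<close> at \<open>z\<close>. The piece from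
        \<open>x\<close> to \<open>z\<close> is therefore free for rerouting whichever path contains
        \<open>x\<close>.\<close>
      obtain s where s: "is_path s" "set s \<subseteq> - {b}" "hd s = b'" "last s = y"
        using avoid[of b b' y] bV yV y b'B snoc.prems(2) unfolding joined_def by blast
      have "b' \<in> set s" using s by (metis is_path_def hd_in_set)
      moreover have "b' \<in> set p" using pq(6) by auto
      ultimately obtain s1 x s2 where x: "s = s1 @ x # s2" "x \<in> set p \<union> set q"
        "\<forall>t\<in>set s2. t \<notin> set p \<union> set q"
        using split_list_last_prop[of s "\<lambda>t. t \<in> set p \<union> set q"] by blast
      have xs2: "is_path (x # s2)" using s(1) x(1) is_path_split by blast
      have xB: "x \<notin> B" using x(1,2) pB qB(1)[of x] True s(2) by auto
      have "last (x # s2) = y" using s(4) x(1) by simp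
      then have "y \<in> set s2" using xB y by (metis last_in_set list.distinct(1) set_ConsD)
      then obtain t1 z t2 where z: "s2 = t1 @ z # t2" "z \<in> B" "\<forall>t\<in>set t1. t \<notin> B"
        using split_list_first_prop[of s2 "\<lambda>t. t \<in> B"] y by blast
      have xt: "is_path (x # t1 @ [z])" using xs2 z is_path_split[of "x # t1" z t2] by simp
      have zb: "z \<noteq> b" using s(2) x(1) z(1) by auto
      have tpq: "set (t1 @ [z]) \<inter> (set p \<union> set q) = {}" using x(3) z(1) by auto
      show ?thesis
      proof (cases "x \<in> set p")
        case True
        \<comment> \<open>The roles are exchanged: \<open>q\<close>, which already ends in
          \<open>b\<close>, becomes the first path, and \<open>p\<close> is diverted at
          \<open>x\<close> to \<open>z\<close>.\<close>
        then obtain p1 p2 where p: "p = p1 @ x # p2" by (meson split_list)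
        have 1: "is_path (p1 @ x # t1 @ [z])"
          using pq(1) xt tpq is_path_split[of p1 x p2] is_path_split[of p1 x "t1 @ [z]"] p by auto
        have 2: "hd (p1 @ x # t1 @ [z]) = hd p" using p by (cases p1) auto
        have 3: "set (p1 @ x # t1 @ [z]) \<inter> B = {z}" using p pB z(2,3) by auto
        have 4: "set (p1 @ x # t1 @ [z]) \<inter> set q = {}" using p pq(3) tpq by auto
        have 5: "last (p1 @ x # t1 @ [z]) = z" by simp
        show ?thesis
        proof (intro exI conjI)
          show "is_path q" by fact
          show "is_path (p1 @ x # t1 @ [z])" by fact
          show "last (p1 @ x # t1 @ [z]) \<in> B - {b}" using 5 z zb by simp
          show "set (p1 @ x # t1 @ [z]) \<inter> B = {last (p1 @ x # t1 @ [z])}" using 3 5 by simp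
          show "{hd q, hd (p1 @ x # t1 @ [z])} = {u, v}" using 2 pq(4) by auto
        qed (use \<open>last q = b\<close> qB' 4 in \<open>simp_all add: Int_commute\<close>)
      next
        case False
        then have "x \<in> set q" using x by blast
        then obtain q1 q2 where q: "q = q1 @ x # q2" by (meson split_list)
        \<comment> \<open>Diverting \<open>q\<close> at \<open>x\<close> frees its end
          \<open>b\<close>, which can now be appended to \<open>p\<close>.\<close>
        have "x \<noteq> b" using s(2) x(1) by auto
        then have "q2 \<noteq> []" using q \<open>last q = b\<close> by auto
        then have bq: "b \<notin> set q1" "b \<in> set q2" using pq(2) \<open>last q = b\<close> unfolding q is_path_def by auto
        have 1: "is_path (q1 @ x # t1 @ [z])"
          using pq(2) xt tpq is_path_split[of q1 x q2] is_path_split[of q1 x "t1 @ [z]"] q by auto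
        have 2: "hd (q1 @ x # t1 @ [z]) = hd q" using q by (cases q1) auto
        have 3: "set (q1 @ x # t1 @ [z]) \<inter> B = {z}"
          using bq(1) q qB(1) z(2,3) xB \<open>last q = b\<close> by auto
        have 4: "set (p @ [b]) \<inter> set (q1 @ x # t1 @ [z]) = {}"
          using bq(1) q pq(3) tpq \<open>x \<noteq> b\<close> \<open>b \<in> set q2\<close> by auto
        have 5: "last (q1 @ x # t1 @ [z]) = z" by simp
        show ?thesis
        proof (intro exI conjI)
          show "is_path (p @ [b])" by fact
          show "is_path (q1 @ x # t1 @ [z])" by fact
          show "last (q1 @ x # t1 @ [z]) \<in> B - {b}" using 5 z zb by simp
          show "set (q1 @ x # t1 @ [z]) \<inter> B = {last (q1 @ x # t1 @ [z])}" using 3 5 by simp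
          show "{hd (p @ [b]), hd (q1 @ x # t1 @ [z])} = {u, v}" using 2 pq(4) pb(2) by auto
        qed (use 4 pB snoc.prems(2) in simp_all)
      qed
    qed
  qed
qed

text \<open>Linking gives two disjoint paths that meet \<open>B\<close> only at their ends, one of
  them in \<open>b\<close>. A full path inside \<open>B\<close> between the two ends connects them
  to one path from \<open>u\<close> to \<open>v\<close>. Which of the two starts at \<open>u\<close>
  is immaterial, since full paths can be reversed.\<close>

lemma rooted_full_joined:
  assumes B: "B \<subseteq> V" "b \<in> B" "B \<noteq> {b}"
    and rooted: "\<And>x. x \<in> B - {b} \<Longrightarrow> full_joined k c B x b"
    and u: "joined (- (B - {b})) u b" and v: "v \<in> V" "v \<noteq> u"
  shows "full_joined k c V u v"
proof -
  obtain r where r: "is_path r" "set r \<subseteq> - (B - {b})" "hd r = u" "last r = b"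
    using u unfolding joined_def by blast
  have "b \<in> set r" using r by (auto simp: is_path_def)
  then have rB: "set r \<inter> B = {b}" using r B by auto
  obtain p q where pq: "is_path p" "is_path q" "set p \<inter> set q = {}" "{hd p, hd q} = {u, v}"
    "last p = b" "set p \<inter> B = {b}" "last q \<in> B - {b}" "set q \<inter> B = {last q}"
    using linking[OF B r(1,3,4) rB v] by (elim exE conjE) (rule that)
  obtain w where w: "is_path w" "set w \<subseteq> B" "hd w = last q" "last w = b" "{..<k} \<subseteq> c ` ledges w"
    using rooted[OF pq(7)] unfolding full_joined_def by blast
  have ne: "p \<noteq> []" "q \<noteq> []" "w \<noteq> []" using pq w by (auto simp: is_path_def)
  obtain q' where q': "q = q' @ [last q]" using ne by (metis append_butlast_last_id)
  obtain p' where p': "p = p' @ [b]" using ne pq(5) by (metis append_butlast_last_id)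
  obtain w' where w': "w = w' @ [b]" using ne w(4) by (metis append_butlast_last_id)
  have "w' \<noteq> []" using w w' pq(7) by auto
  then obtain w'' where w'': "w = last q # w'' @ [b]" using w w' by (cases w') auto
  \<comment> \<open>This is \<open>q\<close>, then \<open>w\<close>, then \<open>p\<close>
    backwards, with each of the two shared vertices listed once.\<close>
  define P where "P = q' @ last q # w'' @ b # rev p'"
  have d: "set q' \<inter> B = {}" "set p' \<inter> B = {}"
  proof -
    have "last q \<notin> set q'" using pq(2) q' by (metis is_path_def distinct_append disjoint_iff list.set_intros(1))
    then show "set q' \<inter> B = {}" using pq(8) q' by (metis Int_iff Un_iff disjoint_iff set_append singletonD)
    have "b \<notin> set p'" using pq(1) unfolding p' is_path_def by simp
    then show "set p' \<inter> B = {}" using pq(6) unfolding p' by auto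
  qed
  have bp: "is_path (b # rev p')" using pq(1) p' is_path_rev[of p] by simp
  have "is_path (last q # w'' @ b # rev p')"
    using is_path_split[of "last q # w''" b "rev p'"] bp w(1,2) w'' d by auto
  moreover have "set q' \<inter> set (w'' @ b # rev p') = {}"
  proof -
    have "set q' \<inter> set p' = {}" using pq(3) arg_cong[OF q', of set] arg_cong[OF p', of set] by auto
    moreover have "set w'' \<subseteq> B" using w(2) w'' by auto
    ultimately show ?thesis using d B(2) by auto
  qed
  ultimately have P: "is_path P"
    unfolding P_def using is_path_split[of q' "last q" "w'' @ b # rev p'"] pq(2) q' by simp
  have "P = q' @ w @ rev p'" unfolding P_def w'' by simp
  then have "ledges w \<subseteq> ledges P" using ledges_append_subset[of q' "w @ rev p'"] ledges_append_subset[of w "rev p'"] by auto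
  then have full: "{..<k} \<subseteq> c ` ledges P" using w(5) by blast
  have "hd P = hd q" unfolding P_def by (metis q' hd_append list.sel(1))
  moreover have "last P = hd p" unfolding P_def using p' by (cases p') simp_all
  moreover have "set P \<subseteq> V" using P by (simp add: is_path_def)
  ultimately have "full_joined k c V (hd q) (hd p)" using P full unfolding full_joined_def by blast
  moreover have "(hd p = u \<and> hd q = v) \<or> (hd p = v \<and> hd q = u)" using pq(4) by (auto simp: doubleton_eq_iff)
  ultimately show ?thesis using full_joined_sym by blast
qed

text \<open>Every vertex of \<open>X\<close> can act as the root, in particular the one at which a
  path from \<open>u\<close> first meets \<open>X\<close>.\<close>

lemma clique_full_joined:
  assumes X: "X \<subseteq> V" "x0 \<in> X" "X \<noteq> {x0}"
    and full: "\<And>x y. x \<in> X \<Longrightarrow> y \<in> X \<Longrightarrow> x \<noteq> y \<Longrightarrow> full_joined k c X x y"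
    and uv: "u \<in> V" "v \<in> V" "v \<noteq> u"
  shows "full_joined k c V u v"
proof -
  from joined_first_hit[OF connected_V X(2)] uv X(1,2) obtain b
    where b: "b \<in> X" "joined (- (X - {b})) u b" by blast
  then show ?thesis
    using rooted_full_joined[of X b k c u v] X b full uv by blast
qed

end

section \<open>Colorings of long cycles, wheels and fans\<close>

lemma surjection_onto_colors:
  assumes "finite S" "1 \<le> k" "k \<le> card S"
  obtains h :: "'b \<Rightarrow> nat" where "h ` S = {..<k}" "\<And>s. h s < k"
proof -
  obtain T where T: "T \<subseteq> S" "card T = k" "finite T"
    using obtain_subset_with_card_n[OF assms(3)] by blast
  then obtain f where f: "bij_betw f T {..<k}"
    by (metis finite_same_card_bij finite_lessThan card_lessThan)
  \<comment> \<open>The default 0 is a legal color because \<open>1 \<le> k\<close>; this keeps the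
    bound valid for all arguments.\<close>
  define h where "h s = (if s \<in> T then f s else 0)" for s
  have lt: "h s < k" for s using f assms(2) by (auto simp: h_def bij_betw_def)
  have "{..<k} \<subseteq> h ` T" using f by (auto simp: h_def bij_betw_def)
  then have "h ` S = {..<k}" using lt T(1) by fastforce
  then show ?thesis using that lt by blast
qed

text \<open>The window excludes \<open>a\<close> because rim edges are indexed by the vertex they
  enter: one turn starting at \<open>a\<close> enters the positions \<open>a + 1\<close> to
  \<open>a + L\<close>.\<close>

lemma residue_in_window:
  fixes q L a :: nat
  assumes "q < L"
  obtains s where "a < s" "s \<le> a + L" "s mod L = q"
proof -
  \<comment> \<open>Round \<open>a\<close> down to a multiple of \<open>L\<close> and add
    \<open>q\<close>; if that does not exceed \<open>a\<close>, go one turn further.\<close>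
  define s where "s = (if a mod L < q then a - a mod L + q else a - a mod L + L + q)"
  have a: "a mod L < L" "a mod L \<le> a" using assms by auto
  have d: "a - a mod L = L * (a div L)" by (simp add: minus_mod_eq_mult_div)
  have "a < s" "s \<le> a + L"
    using a assms unfolding s_def by (cases "a mod L < q"; simp only: if_True if_False; linarith)+
  moreover have "s mod L = q"
  proof (cases "a mod L < q")
    case True
    then show ?thesis using assms unfolding s_def d by simp
  next
    case False
    then have "s = q + L * (a div L + 1)" by (simp add: s_def d)
    then show ?thesis using assms by (simp only: mod_mult_self2 mod_less)
  qed
  ultimately show ?thesis using that by blast
qed

lemma mod_inj_window:
  fixes x y :: nat
  assumes "x \<in> {a<..a + L}" "y \<in> {a<..a + L}" "x mod L = y mod L"
  shows "x = y"
  using assms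
proof (induction x y rule: linorder_wlog)
  case (le x y)
  then have "L dvd y - x" using mod_eq_dvd_iff_nat[of x y L] by simp
  moreover have "y - x < L" using le by auto
  ultimately show ?case using le dvd_imp_le[of L "y - x"] by (cases "y = x") auto
qed auto

text \<open>Indices wrap around, so that an arc passing the end of the list is still an interval of
  indices.\<close>

definition cyc :: "'a list \<Rightarrow> nat \<Rightarrow> 'a" where
  "cyc C t = C ! (t mod length C)"

lemma cyc_add_length [simp]: "cyc C (t + length C) = cyc C t"
  by (simp add: cyc_def)

section \<open>Cycles and fans, with edges colored by the position they enter\<close>

context simple_graph
begin

definition is_cycle :: "'a list \<Rightarrow> bool" where
  "is_cycle C \<longleftrightarrow> is_path C \<and> 3 \<le> length C \<and> adj (last C) (hd C)"

lemma cyc_mem: "is_cycle C \<Longrightarrow> cyc C t \<in> set C"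
  by (auto simp: is_cycle_def cyc_def intro!: nth_mem mod_less_divisor)

lemma in_cycle: "x \<in> set C \<Longrightarrow> \<exists>t < length C. x = cyc C t"
  by (auto simp: in_set_conv_nth cyc_def)

lemma cyc_adj:
  assumes "is_cycle C" shows "adj (cyc C t) (cyc C (Suc t))"
proof -
  have L: "length C > 0" "C \<noteq> []" using assms by (auto simp: is_cycle_def)
  show ?thesis
  proof (cases "Suc (t mod length C) = length C")
    case True
    then have "Suc t mod length C = 0" "t mod length C = length C - 1" by (auto simp: mod_Suc)
    then show ?thesis using assms L unfolding is_cycle_def cyc_def by (simp add: last_conv_nth hd_conv_nth)
  next
    case False
    then have "Suc t mod length C = Suc (t mod length C)" by (simp add: mod_Suc)
    moreover have "Suc (t mod length C) < length C" using False L mod_less_divisor[of "length C" t] by linarith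
    ultimately show ?thesis using assms unfolding is_cycle_def cyc_def is_path_def by (simp add: successively_nth)
  qed
qed

lemma cyc_inj:
  assumes "is_cycle C" shows "inj_on (cyc C) {a<..a + length C}"
proof (rule inj_onI)
  fix x y assume xy: "x \<in> {a<..a + length C}" "y \<in> {a<..a + length C}" "cyc C x = cyc C y"
  have "distinct C" "length C > 0" using assms by (auto simp: is_cycle_def is_path_def)
  then have "x mod length C = y mod length C" using xy(3) by (simp add: cyc_def nth_eq_iff_index_eq)
  then show "x = y" using mod_inj_window xy by blast
qed

lemma cyc_path:
  assumes "is_cycle C" "i \<le> j" "j < i + length C"
  shows "is_path (map (cyc C) [i..<Suc j])"
proof (rule is_path_interval)
  show "inj_on (cyc C) {i..j}"
  proof (rule inj_onI)
    fix x y assume xy: "x \<in> {i..j}" "y \<in> {i..j}" "cyc C x = cyc C y"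
    \<comment> \<open>The window of \<open>cyc_inj\<close> excludes its left end; shifting by a full
      turn avoids subtracting one from \<open>i = 0\<close>.\<close>
    define a where "a = i + length C - 1"
    have "length C > 0" using assms by (auto simp: is_cycle_def)
    then have "x + length C \<in> {a<..a + length C}" "y + length C \<in> {a<..a + length C}"
      using xy assms(3) by (auto simp: a_def)
    then show "x = y" using inj_onD[OF cyc_inj[OF assms(1), of a], of "x + length C" "y + length C"] xy by auto
  qed
  have "set C \<subseteq> V" using assms by (simp add: is_cycle_def is_path_def)
  then show "cyc C ` {i..j} \<subseteq> V" using cyc_mem[OF assms(1)] by auto
qed (use assms(2) cyc_adj[OF assms(1)] in auto)

text \<open>A rim edge is colored by the position it enters and a spoke by its end on the cycle. A
  spoke and the rim edge entering its end thus agree in color, which lets one replace the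
  other.\<close>

lemma cycle_coloring:
  assumes C: "is_cycle C" and h: "\<And>s. h s < (k :: nat)"
  shows "\<exists>c. (\<forall>e. c e < k) \<and> (\<forall>t. c {cyc C t, cyc C (Suc t)} = h (Suc t mod length C)) \<and>
    (\<forall>z t. z \<notin> set C \<longrightarrow> c {z, cyc C t} = h (t mod length C))"
proof -
  let ?L = "length C"
  have L: "?L \<ge> 3" "?L > 0" and d: "distinct C" using C by (auto simp: is_cycle_def is_path_def)
  have eq: "C ! i = C ! j \<longleftrightarrow> i = j" if "i < ?L" "j < ?L" for i j
    using nth_eq_iff_index_eq[OF d that] .
  \<comment> \<open>The larger index is the entered position, except on the closing edge, which
    enters position 0. A spoke has only one index.\<close>
  define c where "c e = h (if e = {C ! (?L - 1), C ! 0} then 0 else Max {t. t < ?L \<and> C ! t \<in> e})" for e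
  show ?thesis
  proof (intro exI[of _ c] conjI allI impI)
    show "c e < k" for e using h by (simp add: c_def)
  next
    fix t
    define r where "r = t mod ?L"
    have r: "r < ?L" using L by (simp add: r_def)
    show "c {cyc C t, cyc C (Suc t)} = h (Suc t mod ?L)"
    proof (cases "Suc r = ?L")
      case True
      then have "Suc t mod ?L = 0" "r = ?L - 1" by (auto simp: mod_Suc r_def)
      then show ?thesis unfolding c_def cyc_def r_def[symmetric] by simp
    next
      case False
      then have S: "Suc t mod ?L = Suc r" by (simp add: mod_Suc r_def)
      have r': "Suc r < ?L" using False r by linarith
      \<comment> \<open>Here length at least 3 separates the closing edge from the other rim
        edges.\<close>
      have "C ! 0 \<notin> {C ! r, C ! Suc r} \<or> C ! (?L - 1) \<notin> {C ! r, C ! Suc r}"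
        using r r' L eq by auto
      then have ne: "{C ! r, C ! Suc r} \<noteq> {C ! (?L - 1), C ! 0}" by blast
      have "{s. s < ?L \<and> C ! s \<in> {C ! r, C ! Suc r}} = {r, Suc r}" using r r' eq by auto
      then have "Max {s. s < ?L \<and> C ! s \<in> {C ! r, C ! Suc r}} = Suc r" by simp
      then show ?thesis unfolding c_def cyc_def r_def[symmetric] S using ne by simp
    qed
  next
    fix z t assume z: "z \<notin> set C"
    define r where "r = t mod ?L"
    have r: "r < ?L" using L by (simp add: r_def)
    have "C ! 0 \<in> set C" "C ! (?L - 1) \<in> set C" using L by auto
    then have ne: "{z, C ! r} \<noteq> {C ! (?L - 1), C ! 0}" using z by (auto simp: doubleton_eq_iff)
    have "{s. s < ?L \<and> C ! s \<in> {z, C ! r}} = {r}" using r z eq by auto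
    then have "Max {s. s < ?L \<and> C ! s \<in> {z, C ! r}} = r" by simp
    then show "c {z, cyc C t} = h (t mod ?L)" unfolding c_def cyc_def r_def[symmetric] using ne by simp
  qed
qed

text \<open>Position \<open>s\<close> gets the color \<open>s mod k\<close>. Of the two arcs between
  positions \<open>a < b\<close>, the one from \<open>a\<close> to \<open>b\<close> is full if it
  has at least \<open>k\<close> edges. Otherwise the arc through the closing edge is full, even when
  \<open>k\<close> does not divide the length.\<close>

lemma long_cycle_full_joined:
  assumes C: "is_cycle C" and k: "1 \<le> k" "2 * k \<le> length C"
  obtains c where "\<And>e. c e < k"
    and "\<And>x y. x \<in> set C \<Longrightarrow> y \<in> set C \<Longrightarrow> x \<noteq> y \<Longrightarrow> full_joined k c (set C) x y"
proof -
  let ?L = "length C"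
  have "s mod k < k" for s using k(1) by simp
  from cycle_coloring[OF C, of "\<lambda>s. s mod k" k, OF this] obtain c
    where c': "\<forall>e. c e < k" "\<forall>t. c {cyc C t, cyc C (Suc t)} = (Suc t mod ?L) mod k" by blast
  have c: "c e < k" "c {cyc C t, cyc C (Suc t)} = (Suc t mod ?L) mod k" for e t using c' by blast+
  have arc: "full_joined k c (set C) (cyc C i) (cyc C j)"
    if ij: "i \<le> j" "j < i + ?L" and q: "\<And>q. q < k \<Longrightarrow> \<exists>s. i < s \<and> s \<le> j \<and> s mod ?L mod k = q" for i j
    unfolding full_joined_def
  proof (intro exI conjI)
    show "is_path (map (cyc C) [i..<Suc j])" using cyc_path C ij by blast
    show "{..<k} \<subseteq> c ` ledges (map (cyc C) [i..<Suc j])"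
    proof
      fix q assume "q \<in> {..<k}"
      then obtain s where s: "i < s" "s \<le> j" "s mod ?L mod k = q" using q by blast
      then have "{cyc C (s - 1), cyc C (Suc (s - 1))} \<in> ledges (map (cyc C) [i..<Suc j])"
        unfolding ledges_map_interval by (intro CollectI exI[of _ "s - 1"]) auto
      moreover have "c {cyc C (s - 1), cyc C (Suc (s - 1))} = q" unfolding c(2) using s by simp
      ultimately show "q \<in> c ` ledges (map (cyc C) [i..<Suc j])" by blast
    qed
  qed (use ij cyc_mem[OF C] in \<open>auto simp: hd_map last_map simp del: upt_Suc\<close>)
  have *: "full_joined k c (set C) (cyc C a) (cyc C b)" if ab: "a < b" "b < ?L" for a b
  proof (cases "a + k \<le> b")
    case True
    show ?thesis
    proof (rule arc)
      fix q assume "q < k"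
      then obtain s where "a < s" "s \<le> a + k" "s mod k = q" using residue_in_window by blast
      then show "\<exists>s. a < s \<and> s \<le> b \<and> s mod ?L mod k = q" using True ab by (intro exI[of _ s]) auto
    qed (use ab in auto)
  next
    case False
    have "full_joined k c (set C) (cyc C b) (cyc C (a + ?L))"
    proof (rule arc)
      fix q assume q: "q < k"
      show "\<exists>s. b < s \<and> s \<le> a + ?L \<and> s mod ?L mod k = q"
      \<comment> \<open>Color \<open>q\<close> occurs at position \<open>q\<close> after the wrap if
        \<open>q \<le> a\<close>. Otherwise it occurs at \<open>k + q\<close>, which lies beyond
        \<open>b < a + k\<close> and before the wrap because
        \<open>k + q < 2 * k \<le> ?L\<close>.\<close>
      proof (cases "q \<le> a")
        case True
        then show ?thesis using ab q by (intro exI[of _ "?L + q"]) auto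
      next
        case False
        then show ?thesis using \<open>\<not> a + k \<le> b\<close> k q ab by (intro exI[of _ "k + q"]) auto
      qed
    qed (use ab in auto)
    then show ?thesis using full_joined_sym by auto
  qed
  show ?thesis
  proof (rule that[of c])
    fix x y assume xy: "x \<in> set C" "y \<in> set C" "x \<noteq> y"
    then obtain a b where ab: "a < ?L" "x = cyc C a" "b < ?L" "y = cyc C b" using in_cycle by metis
    then have "a < b \<or> b < a" using xy(3) by (metis nat_neq_iff)
    then show "full_joined k c (set C) x y" using * ab full_joined_sym by blast
  qed (rule c(1))
qed

text \<open>A path leaves \<open>x\<close> backwards up to the first spoke end after \<open>y\<close>, crosses \<open>z\<close> to the first spoke end
  after \<open>x\<close>, and goes on to \<open>y\<close>. It contains, for every spoke end, the spoke or the rim edge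
  entering it.\<close>

lemma wheel_full_joined:
  assumes C: "is_cycle C" and z: "z \<in> V" "z \<notin> set C"
    and k: "1 \<le> k" "k \<le> card {y \<in> set C. adj z y}"
  obtains c where "\<And>e. c e < k"
    and "\<And>x y. x \<in> insert z (set C) \<Longrightarrow> y \<in> insert z (set C) \<Longrightarrow> x \<noteq> y \<Longrightarrow>
           full_joined k c (insert z (set C)) x y"
proof -
  let ?L = "length C" and ?X = "insert z (set C)"
  have L: "?L > 0" using C by (auto simp: is_cycle_def)
  have CV: "set C \<subseteq> V" using C by (simp add: is_cycle_def is_path_def)
  define S where "S = {s. s < ?L \<and> adj z (C ! s)}"
  have "{y \<in> set C. adj z y} = (!) C ` S" by (auto simp: S_def in_set_conv_nth)
  then have "k \<le> card S" using k(2) card_image_le[of S "(!) C"] by (simp add: S_def)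
  then obtain h where h: "h ` S = {..<k}" "\<And>s. h s < k"
    using surjection_onto_colors[of S k] k(1) by (auto simp: S_def)
  define T where "T t \<longleftrightarrow> adj z (cyc C t)" for t
  have spoke: "\<exists>s. a < s \<and> s \<le> a + ?L \<and> T s \<and> h (s mod ?L) = q" if "q < k" for a q
  proof -
    have "q \<in> h ` S" using h(1) \<open>q < k\<close> by simp
    then obtain r where r: "r \<in> S" "h r = q" by blast
    then have "r < ?L" by (simp add: S_def)
    from residue_in_window[OF this, of a] obtain s where "a < s" "s \<le> a + ?L" "s mod ?L = r" .
    then show ?thesis using r by (intro exI[of _ s]) (auto simp: T_def cyc_def S_def)
  qed
  obtain c where c': "\<forall>e. c e < k" "\<forall>t. c {cyc C t, cyc C (Suc t)} = h (Suc t mod ?L)"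
    "\<forall>z t. z \<notin> set C \<longrightarrow> c {z, cyc C t} = h (t mod ?L)"
    using cycle_coloring[OF C, of h k, OF h(2)] by blast
  have c: "c e < k" "c {cyc C t, cyc C (Suc t)} = h (Suc t mod ?L)" "c {z, cyc C t} = h (t mod ?L)" for e t
    using c' z(2) by blast+
  have rim: "h (s mod ?L) \<in> c ` ledges (map (cyc C) [i..<Suc j])" if "i < s" "s \<le> j" for i j s
  proof -
    have "{cyc C (s - 1), cyc C (Suc (s - 1))} \<in> ledges (map (cyc C) [i..<Suc j])"
      unfolding ledges_map_interval using that by (intro CollectI exI[of _ "s - 1"]) auto
    moreover have "c {cyc C (s - 1), cyc C (Suc (s - 1))} = h (s mod ?L)" unfolding c(2) using that by simp
    ultimately show ?thesis by (metis imageI)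
  qed
  have seg: "map (cyc C) [i..<Suc j] \<noteq> []" "hd (map (cyc C) [i..<Suc j]) = cyc C i"
    "last (map (cyc C) [i..<Suc j]) = cyc C j" "set (map (cyc C) [i..<Suc j]) \<subseteq> set C"
    "set (map (cyc C) [i..<Suc j]) = cyc C ` {i..j}" if "i \<le> j" for i j
    using that cyc_mem[OF C] by (auto simp: hd_map last_map atLeastLessThanSuc_atLeastAtMost simp del: upt_Suc)
  \<comment> \<open>If the complementary arc enters no spoke end, the rim edges from
    \<open>i\<close> to \<open>j\<close> enter all of them and carry every color without using
    \<open>z\<close>.\<close>
  have arc: "full_joined k c ?X (cyc C i) (cyc C j)"
    if ij: "i \<le> j" "j < i + ?L"
      and none: "\<And>s. j < s \<Longrightarrow> s \<le> i + ?L \<Longrightarrow> \<not> T s" for i j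
    unfolding full_joined_def
  proof (intro exI conjI)
    show "is_path (map (cyc C) [i..<Suc j])" using cyc_path C ij by blast
    show "{..<k} \<subseteq> c ` ledges (map (cyc C) [i..<Suc j])"
    proof
      fix q assume "q \<in> {..<k}"
      then obtain s where s: "i < s" "s \<le> i + ?L" "T s" "h (s mod ?L) = q" using spoke by blast
      then have "s \<le> j" using none[of s] by (metis not_le)
      then show "q \<in> c ` ledges (map (cyc C) [i..<Suc j])" using rim s by blast
    qed
  qed (use ij seg in auto)
  have *: "full_joined k c ?X (cyc C a) (cyc C b)" if ab: "a < b" "b < ?L" for a b
  proof (cases "\<exists>s. b < s \<and> s \<le> a + ?L \<and> T s")
    case False
    then show ?thesis using arc[of a b] ab by auto
  next
    case b: True
    show ?thesis
    proof (cases "\<exists>s. a < s \<and> s \<le> b \<and> T s")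
      case False
      have "\<not> T s" if "a + ?L < s" "s \<le> b + ?L" for s
      proof -
        have "cyc C (s - ?L) = cyc C s" using cyc_add_length[of C "s - ?L"] that by simp
        moreover have "\<not> T (s - ?L)" using False that by (meson less_diff_conv le_diff_conv)
        ultimately show ?thesis by (simp add: T_def)
      qed
      then have "full_joined k c ?X (cyc C b) (cyc C (a + ?L))" using ab by (intro arc[of b "a + ?L"]) auto
      then show ?thesis using full_joined_sym by auto
    next
      case a: True
      \<comment> \<open>The only rim edges into spoke ends that the path omits are those entering
        \<open>a'\<close> and \<open>b'\<close>; the two spokes used have exactly these
        colors.\<close>
      define a' where "a' = (LEAST s. a < s \<and> T s)"
      define b' where "b' = (LEAST s. b < s \<and> T s)"
      have a': "a < a'" "T a'" "\<And>s. a < s \<Longrightarrow> T s \<Longrightarrow> a' \<le> s"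
        unfolding a'_def using a LeastI_ex[of "\<lambda>s. a < s \<and> T s"] by (auto intro: Least_le)
      have b': "b < b'" "T b'" "\<And>s. b < s \<Longrightarrow> T s \<Longrightarrow> b' \<le> s"
        unfolding b'_def using b LeastI_ex[of "\<lambda>s. b < s \<and> T s"] by (auto intro: Least_le)
      have le: "a' \<le> b" "b' \<le> a + ?L" using a b a' b' by (meson le_trans)+
      let ?P = "map (cyc C) [b'..<Suc (a + ?L)]" and ?Q = "map (cyc C) [a'..<Suc b]"
      have "cyc C ` {b'..a + ?L} \<inter> cyc C ` {a'..b} = cyc C ` ({b'..a + ?L} \<inter> {a'..b})"
        by (rule inj_on_image_Int[OF cyc_inj[OF C, of a], symmetric]) (use a'(1) b'(1) le ab in auto)
      also have "{b'..a + ?L} \<inter> {a'..b} = {}" using b'(1) by auto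
      finally have disj: "set ?P \<inter> set ?Q = {}" unfolding seg(5)[OF le(1)] seg(5)[OF le(2)] by simp
      have PQ: "is_path ?P" "is_path ?Q"
        by (rule cyc_path[OF C]; use le a'(1) b'(1) ab in linarith)+
      have zQ: "is_path (z # ?Q)"
        using PQ seg[OF le(1)] z a'(2) by (auto simp: is_path_Cons T_def simp del: upt_Suc)
      have path: "is_path (rev ?P @ z # ?Q)"
        using PQ zQ seg[OF le(2)] z b'(2) disj adj_sym
        by (subst is_path_append) (auto simp: T_def last_rev simp del: upt_Suc)
      have led: "ledges (rev ?P @ z # ?Q) =
          insert {cyc C b', z} (ledges ?P \<union> insert {z, cyc C a'} (ledges ?Q))"
        using seg[OF le(1)] seg[OF le(2)] by (simp add: ledges_append ledges_Cons last_rev del: upt_Suc)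
      have "{..<k} \<subseteq> c ` ledges (rev ?P @ z # ?Q)"
      proof
        fix q assume "q \<in> {..<k}"
        then obtain s where s: "a < s" "s \<le> a + ?L" "T s" "h (s mod ?L) = q" using spoke by blast
        show "q \<in> c ` ledges (rev ?P @ z # ?Q)"
        proof (cases "s \<le> b")
          case True
          show ?thesis
          proof (cases "s = a'")
            case True
            then show ?thesis unfolding led using s(4) c(3)[of a'] by (auto simp: insert_commute simp del: upt_Suc)
          next
            case False
            then have "a' < s" using a'(3)[OF s(1,3)] by simp
            then show ?thesis unfolding led using rim[of a' s b] True s(2,4) by (auto simp del: upt_Suc)
          qed
        next
          case sb: False
          show ?thesis
          proof (cases "s = b'")
            case True
            then show ?thesis unfolding led using s(4) c(3)[of b'] by (auto simp: insert_commute simp del: upt_Suc)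
          next
            case False
            then have "b' < s" using b'(3)[of s] s(3) sb by simp
            then show ?thesis unfolding led using rim[of b' s "a + ?L"] s(2,4) by (auto simp del: upt_Suc)
          qed
        qed
      qed
      then show ?thesis unfolding full_joined_def using path seg[OF le(1)] seg[OF le(2)]
        by (intro exI[of _ "rev ?P @ z # ?Q"]) (auto simp: hd_rev simp del: upt_Suc)
    qed
  qed
  \<comment> \<open>From \<open>z\<close> the path goes to the first spoke end after
    \<open>b\<close> and then along the rim to \<open>b\<close>, reached as
    \<open>b + ?L\<close>.\<close>
  have **: "full_joined k c ?X z (cyc C b)" for b
  proof -
    have b: "\<exists>s. b < s \<and> s \<le> b + ?L \<and> T s" using spoke[of 0 b] k(1) by auto
    define b' where "b' = (LEAST s. b < s \<and> T s)"
    have b': "b < b'" "T b'" "\<And>s. b < s \<Longrightarrow> T s \<Longrightarrow> b' \<le> s"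
      unfolding b'_def using b LeastI_ex[of "\<lambda>s. b < s \<and> T s"] by (auto intro: Least_le)
    have le: "b' \<le> b + ?L" using b b' by (meson le_trans)
    let ?Q = "map (cyc C) [b'..<Suc (b + ?L)]"
    have "is_path ?Q" by (rule cyc_path[OF C]; use le b'(1) in linarith)
    then have path: "is_path (z # ?Q)"
      using seg[OF le] z b'(2) by (auto simp: is_path_Cons T_def simp del: upt_Suc)
    have led: "ledges (z # ?Q) = insert {z, cyc C b'} (ledges ?Q)"
      using seg[OF le] by (simp add: ledges_Cons del: upt_Suc)
    have "{..<k} \<subseteq> c ` ledges (z # ?Q)"
    proof
      fix q assume "q \<in> {..<k}"
      then obtain s where s: "b < s" "s \<le> b + ?L" "T s" "h (s mod ?L) = q" using spoke by blast
      show "q \<in> c ` ledges (z # ?Q)"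
      proof (cases "s = b'")
        case True
        then show ?thesis unfolding led using s(4) c(3)[of b'] by (auto simp: insert_commute simp del: upt_Suc)
      next
        case False
        then have "b' < s" using b'(3)[OF s(1,3)] by simp
        then show ?thesis unfolding led using rim[of b' s "b + ?L"] s(2,4) by (auto simp del: upt_Suc)
      qed
    qed
    then show ?thesis unfolding full_joined_def using path seg[OF le]
      by (intro exI[of _ "z # ?Q"]) (auto simp del: upt_Suc)
  qed
  show ?thesis
  proof (rule that[of c])
    fix x y assume xy: "x \<in> ?X" "y \<in> ?X" "x \<noteq> y"
    show "full_joined k c ?X x y"
    proof (cases "x = z \<or> y = z")
      case True
      then show ?thesis using xy ** in_cycle full_joined_sym by (metis insertE)
    next
      case False
      then obtain a b where ab: "a < ?L" "x = cyc C a" "b < ?L" "y = cyc C b"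
        using xy in_cycle by (metis insertE)
      then have "a < b \<or> b < a" using xy(3) by (metis nat_neq_iff)
      then show ?thesis using * ab full_joined_sym by blast
    qed
  qed (rule c(1))
qed

text \<open>From \<open>v s\<close> go back to \<open>v 0\<close>, jump to the first neighbor
  \<open>v s'\<close> of \<open>v 0\<close> beyond \<open>s\<close>, and go on to
  \<open>v i\<close>. Each index in \<open>S\<close> other than \<open>s'\<close> is entered along
  the path, and \<open>s'\<close> is entered by the chord of the same color.\<close>

lemma fan_full_joined:
  assumes v: "inj_on v {0..i}" "\<And>t. t < i \<Longrightarrow> adj (v t) (v (Suc t))" "v ` {0..i} \<subseteq> V"
    and S: "S = {s \<in> {1..i}. adj (v 0) (v s)}" "i \<in> S" and k: "1 \<le> k" "k \<le> card S"
  obtains c where "\<And>e. c e < k"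
    and "\<And>x. x \<in> v ` {0..i} - {v i} \<Longrightarrow> full_joined k c (v ` {0..i}) x (v i)"
proof -
  obtain h where h: "h ` S = {..<k}" "\<And>s. h s < k"
    using surjection_onto_colors[of S k] k by (auto simp: S(1))
  \<comment> \<open>The larger index is the entered one, both for path edges and for chords from
    \<open>v 0\<close>.\<close>
  define c where "c e = h (Max {t \<in> {0..i}. v t \<in> e})" for e
  have c: "c {v a, v b} = h b" if "a < b" "b \<le> i" for a b
  proof -
    have "{t \<in> {0..i}. v t \<in> {v a, v b}} = {a, b}" using that v(1) by (auto simp: inj_on_def)
    then show ?thesis using that by (simp add: c_def)
  qed
  have path: "is_path (map v [a..<Suc b])" if "a \<le> b" "b \<le> i" for a b
  proof (rule is_path_interval)
    show "inj_on v {a..b}" using v(1) that by (auto intro: inj_on_subset)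
  qed (use that v in auto)
  have rim: "h s \<in> c ` ledges (map v [a..<Suc b])" if "a < s" "s \<le> b" "b \<le> i" for a b s
  proof -
    have "{v (s - 1), v (Suc (s - 1))} \<in> ledges (map v [a..<Suc b])"
      unfolding ledges_map_interval using that by (intro CollectI exI[of _ "s - 1"]) auto
    moreover have "c {v (s - 1), v (Suc (s - 1))} = h s" using c[of "s - 1" s] that by simp
    ultimately show ?thesis by (metis imageI)
  qed
  have seg: "map v [a..<Suc b] \<noteq> []" "hd (map v [a..<Suc b]) = v a"
    "last (map v [a..<Suc b]) = v b" "set (map v [a..<Suc b]) = v ` {a..b}" if "a \<le> b" for a b
    using that by (auto simp: hd_map last_map atLeastLessThanSuc_atLeastAtMost simp del: upt_Suc)
  show ?thesis
  proof (rule that[of c])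
    show "c e < k" for e using h by (simp add: c_def)
  next
    fix x assume "x \<in> v ` {0..i} - {v i}"
    then obtain s where s: "x = v s" "s \<le> i" "v s \<noteq> v i" by auto
    then have si: "s < i" by (metis le_neq_implies_less)
    \<comment> \<open>Such an index exists because \<open>i\<close> itself belongs to
      \<open>S\<close>.\<close>
    define s' where "s' = (LEAST t. s < t \<and> t \<in> S)"
    have s': "s < s'" "s' \<in> S" "\<And>t. s < t \<Longrightarrow> t \<in> S \<Longrightarrow> s' \<le> t"
      unfolding s'_def using si S(2) LeastI[of "\<lambda>t. s < t \<and> t \<in> S" i] by (auto intro: Least_le)
    have le: "s' \<le> i" and le0: "0 \<le> s" using s' S(1) by auto
    let ?P = "map v [0..<Suc s]" and ?Q = "map v [s'..<Suc i]"
    have "v ` {0..s} \<inter> v ` {s'..i} = v ` ({0..s} \<inter> {s'..i})"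
      by (rule inj_on_image_Int[OF v(1), symmetric]) (use s le in auto)
    also have "{0..s} \<inter> {s'..i} = {}" using s'(1) by auto
    finally have disj: "set ?P \<inter> set ?Q = {}" unfolding seg(4)[OF le] seg(4)[OF le0] by simp
    have P: "is_path (rev ?P @ ?Q)"
      using path[of 0 s] path[OF le] seg[of 0 s] seg[OF le] s disj s'(2) S(1)
      by (subst is_path_append) (auto simp: last_rev simp del: upt_Suc)
    have led: "ledges (rev ?P @ ?Q) = insert {v 0, v s'} (ledges ?P \<union> ledges ?Q)"
      using seg[of 0 s] seg[OF le] by (simp add: ledges_append last_rev del: upt_Suc)
    have "{..<k} \<subseteq> c ` ledges (rev ?P @ ?Q)"
    proof
      fix q assume "q \<in> {..<k}"
      then have "q \<in> h ` S" using h(1) by simp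
      then obtain t where t: "t \<in> S" "h t = q" by blast
      then have ti: "1 \<le> t" "t \<le> i" using S(1) by auto
      consider "t \<le> s" | "t = s'" | "s' < t" using s'(3)[OF _ t(1)] by (metis le_neq_implies_less not_le)
      then show "q \<in> c ` ledges (rev ?P @ ?Q)"
      proof cases
        case 1
        then show ?thesis unfolding led using rim[of 0 t s] t ti s by (auto simp del: upt_Suc)
      next
        case 2
        then show ?thesis unfolding led using c[of 0 t] t ti by (auto simp del: upt_Suc)
      next
        case 3
        then show ?thesis unfolding led using rim[of s' t i] t ti by (auto simp del: upt_Suc)
      qed
    qed
    then show "full_joined k c (v ` {0..i}) x (v i)" unfolding full_joined_def s(1)
      using P seg[of 0 s] seg[OF le] s le
      by (intro exI[of _ "rev ?P @ ?Q"]) (auto simp: hd_rev simp del: upt_Suc)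
  qed
qed

end

section \<open>Longest paths and crossings\<close>

context simple_graph
begin

lemma is_path_nth:
  assumes "is_path p"
  shows "inj_on ((!) p) {..<length p}" "Suc t < length p \<Longrightarrow> adj (p ! t) (p ! Suc t)"
    "(!) p ` {..<length p} = set p" "set p \<subseteq> V"
  using assms by (auto simp: is_path_def successively_nth inj_on_nth in_set_conv_nth)

lemma joined_segment:
  assumes p: "is_path p" and "i \<le> j" "j < length p"
  shows "joined ((!) p ` {i..j}) (p ! i) (p ! j)"
  unfolding joined_def
proof (intro exI conjI)
  show "is_path (map ((!) p) [i..<Suc j])"
  proof (rule is_path_interval)
    show "inj_on ((!) p) {i..j}" using is_path_nth(1)[OF p] assms by (auto intro: inj_on_subset)
    show "(!) p ` {i..j} \<subseteq> V" using is_path_nth(4)[OF p] assms by (auto intro: nth_mem)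
  qed (use assms is_path_nth(2)[OF p] in auto)
qed (use assms in \<open>auto simp: hd_map last_map simp del: upt_Suc\<close>)

lemma card_neighbour_indices:
  assumes "is_path p"
  shows "card {t. t < length p \<and> adj x (p ! t)} = card {y \<in> set p. adj x y}"
proof -
  have "{y \<in> set p. adj x y} = (!) p ` {t. t < length p \<and> adj x (p ! t)}"
    by (auto simp: in_set_conv_nth)
  moreover have "inj_on ((!) p) {t. t < length p \<and> adj x (p ! t)}"
    using is_path_nth(1)[OF assms] by (auto intro: inj_on_subset)
  ultimately show ?thesis by (simp add: card_image)
qed

text \<open>Follow \<open>p\<close> to \<open>p ! i\<close>, take the chord to the last vertex, go
  backwards to \<open>p ! j\<close> and return by the chord to \<open>p ! 0\<close>.\<close>

lemma crossing_cycle: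
  assumes p: "is_path p" and ij: "i < j" "j < length p" "3 \<le> i + 1 + length p - j"
    and a: "adj (p ! 0) (p ! j)" "adj (last p) (p ! i)"
  shows "is_cycle (take (Suc i) p @ rev (drop j p))"
proof -
  have ne: "take (Suc i) p \<noteq> []" "drop j p \<noteq> []" "p \<noteq> []" using ij by auto
  have s: "successively adj (take (Suc i) p)" "successively adj (drop j p)"
    using p unfolding is_path_def successively_conv_nth by auto
  have st: "is_path (take (Suc i) p)" "is_path (drop j p)"
    using p s ne set_take_subset[of "Suc i" p] set_drop_subset[of j p] unfolding is_path_def by auto
  have d: "set (take (Suc i) p) \<inter> set (drop j p) = {}"
    using p ij by (simp add: is_path_def set_take_disj_set_drop_if_distinct)
  have "last (take (Suc i) p) = p ! i" using ij by (simp add: take_Suc_conv_app_nth)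
  moreover have "hd (rev (drop j p)) = last p" using ij by (simp add: hd_rev)
  ultimately have "is_path (take (Suc i) p @ rev (drop j p))"
    using st d ne a(2) by (subst is_path_append) (auto simp: adj_sym)
  moreover have "hd (take (Suc i) p @ rev (drop j p)) = p ! 0" using ne by (simp add: hd_append hd_conv_nth del: append_is_Nil_conv)
  moreover have "last (take (Suc i) p @ rev (drop j p)) = p ! j" using ne ij by (simp add: last_rev hd_drop_conv_nth)
  ultimately show ?thesis unfolding is_cycle_def using ij a(1) adj_sym by auto
qed

text \<open>Dirac's pigeonhole: the neighbor indices of the first vertex, shifted down by one, and
  those of the last vertex both lie among \<open>length p - 1 < 2 * d\<close> values, so they share
  one.\<close>

lemma adjacent_crossing:
  assumes p: "is_path p" "length p \<le> 2 * d" "1 \<le> length p"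
    and deg: "d \<le> card {y \<in> set p. adj (p ! 0) y}" "d \<le> card {y \<in> set p. adj (last p) y}"
  obtains i where "Suc i < length p" "adj (p ! 0) (p ! Suc i)" "adj (last p) (p ! i)"
proof -
  let ?m = "length p"
  define N where "N x = {t. t < ?m \<and> adj x (p ! t)}" for x
  have last: "last p = p ! (?m - 1)" using p by (simp add: is_path_def last_conv_nth)
  have card: "d \<le> card (N (p ! 0))" "d \<le> card (N (last p))"
    using deg card_neighbour_indices[OF p(1)] by (simp_all add: N_def)
  have pos: "0 < t" if "t \<in> N (p ! 0)" for t using that adj_irrefl by (auto simp: N_def intro: gr0I)
  have N2: "N (last p) \<subseteq> {..<?m - 1}"
  proof
    fix t assume "t \<in> N (last p)"
    then have "t < ?m" "t \<noteq> ?m - 1" using adj_irrefl last by (auto simp: N_def)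
    then show "t \<in> {..<?m - 1}" by simp
  qed
  have N1: "(\<lambda>t. t - 1) ` N (p ! 0) \<subseteq> {..<?m - 1}" using pos by (force simp: N_def)
  have "inj_on (\<lambda>t. t - 1) (N (p ! 0))" using pos by (intro inj_onI) (metis One_nat_def Suc_pred)
  then have c1: "d \<le> card ((\<lambda>t. t - 1) ` N (p ! 0))" using card by (simp add: card_image)
  have "(\<lambda>t. t - 1) ` N (p ! 0) \<inter> N (last p) \<noteq> {}"
  proof
    assume "(\<lambda>t. t - 1) ` N (p ! 0) \<inter> N (last p) = {}"
    then have "card ((\<lambda>t. t - 1) ` N (p ! 0) \<union> N (last p)) = card ((\<lambda>t. t - 1) ` N (p ! 0)) + card (N (last p))"
      by (intro card_Un_disjoint) (auto simp: N_def)
    moreover have "card ((\<lambda>t. t - 1) ` N (p ! 0) \<union> N (last p)) \<le> ?m - 1"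
      using card_mono[OF _ Un_least[OF N1 N2]] by simp
    ultimately show False using c1 card p by linarith
  qed
  then obtain t where t: "t \<in> N (p ! 0)" "t - 1 \<in> N (last p)" by blast
  then show ?thesis using that[of "t - 1"] pos[OF t(1)] by (auto simp: N_def)
qed

text \<open>The edges of a path inside \<open>X\<close> are two-element subsets of \<open>X\<close>.
  This allows colorings of two sets with at most one common vertex to be combined.\<close>

lemma full_joined_recolor:
  assumes "full_joined k c X x y" "\<And>e. e \<subseteq> X \<Longrightarrow> card e = 2 \<Longrightarrow> c' e = c e"
  shows "full_joined k c' X x y"
proof -
  obtain p where p: "is_path p" "set p \<subseteq> X" "hd p = x" "last p = y" "{..<k} \<subseteq> c ` ledges p"
    using assms unfolding full_joined_def by blast
  have "e \<subseteq> set q \<and> card e = 2" if "e \<in> ledges q" "distinct q" for e and q :: "'a list"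
    using that by (induction q rule: ledges.induct) auto
  then have "c' e = c e" if "e \<in> ledges p" for e
    using that assms(2) p(1,2) unfolding is_path_def by (meson subset_trans)
  then have "c' ` ledges p = c ` ledges p" by (intro image_cong) auto
  then show ?thesis using p unfolding full_joined_def by (intro exI[of _ p]) simp
qed

text \<open>The fan consists of the initial stretch of \<open>p\<close> up to the last neighbor of
  its first vertex, so it contains all the neighbors.\<close>

lemma path_fan_full_joined:
  assumes p: "is_path p" and N: "{y. adj (hd p) y} \<subseteq> set p" and k: "1 \<le> k" "k \<le> card {y. adj (hd p) y}"
  obtains i c where "1 \<le> i" "i < length p" "adj (hd p) (p ! i)"
    and "\<And>t. t < length p \<Longrightarrow> adj (hd p) (p ! t) \<Longrightarrow> t \<le> i"
    and "\<And>e. c e < k"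
    and "\<And>x. x \<in> (!) p ` {0..i} - {p ! i} \<Longrightarrow> full_joined k c ((!) p ` {0..i}) x (p ! i)"
proof -
  have hd: "hd p = p ! 0" using p by (simp add: is_path_def hd_conv_nth)
  define S where "S = {t. t < length p \<and> adj (hd p) (p ! t)}"
  have "{y \<in> set p. adj (hd p) y} = {y. adj (hd p) y}" using N by blast
  then have S: "k \<le> card S" "finite S" using card_neighbour_indices[OF p, of "hd p"] k by (auto simp: S_def)
  then have "S \<noteq> {}" using k by auto
  define i where "i = Max S"
  have i: "i \<in> S" "\<And>t. t \<in> S \<Longrightarrow> t \<le> i" using S \<open>S \<noteq> {}\<close> by (auto simp: i_def)
  have pos: "1 \<le> t" if "t \<in> S" for t
    using that adj_irrefl hd by (cases t) (auto simp: S_def)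
  have il: "i < length p" using i by (simp add: S_def)
  have S': "S = {s \<in> {1..i}. adj (p ! 0) (p ! s)}" using i pos il by (auto simp: S_def hd)
  obtain c where c: "\<And>e. c e < k"
    "\<And>x. x \<in> (!) p ` {0..i} - {p ! i} \<Longrightarrow> full_joined k c ((!) p ` {0..i}) x (p ! i)"
  proof (rule fan_full_joined[OF _ _ _ S' i(1) k(1) S(1)])
    show "inj_on ((!) p) {0..i}" using is_path_nth(1)[OF p] il by (auto intro: inj_on_subset)
    show "(!) p ` {0..i} \<subseteq> V" using is_path_nth(4)[OF p] il by (auto intro: nth_mem)
  qed (use il is_path_nth(2)[OF p] in auto)
  show ?thesis using that[of i c] c i pos il by (auto simp: S_def)
qed

end

section \<open>Coloring the whole graph according to a longest path\<close>

context biconnected_graph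
begin

text \<open>Without a crossing, the fan \<open>X\<close> at the start and the fan \<open>Y\<close>
  at the end share at most one vertex. If \<open>u\<close> first meets \<open>p\<close> at index
  \<open>t \<le> j\<close>, following \<open>p\<close> forward leads to the root of \<open>Y\<close>
  and avoids the rest of \<open>Y\<close>; otherwise following it backwards does the same for
  \<open>X\<close>.\<close>

lemma two_fans_full_joined:
  assumes p: "is_path p" and k: "1 \<le> k"
    and N1: "{y. adj (hd p) y} \<subseteq> set p" "k \<le> card {y. adj (hd p) y}"
    and N2: "{y. adj (last p) y} \<subseteq> set p" "k \<le> card {y. adj (last p) y}"
    and nocross: "\<And>i j. i < j \<Longrightarrow> j < length p \<Longrightarrow> adj (hd p) (p ! j) \<Longrightarrow> \<not> adj (last p) (p ! i)"
  shows "\<exists>c. (\<forall>e. c e < k) \<and> (\<forall>u \<in> V. \<forall>v \<in> V. u \<noteq> v \<longrightarrow> full_joined k c V u v)"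
proof -
  let ?m = "length p"
  have m: "0 < ?m" using p by (simp add: is_path_def)
  then have lm: "t \<le> ?m - Suc 0 \<longleftrightarrow> t < ?m" for t by linarith
  obtain i cA where A: "1 \<le> i" "i < ?m" "adj (hd p) (p ! i)" "\<And>e. cA e < k"
    "\<And>x. x \<in> (!) p ` {0..i} - {p ! i} \<Longrightarrow> full_joined k cA ((!) p ` {0..i}) x (p ! i)"
    using path_fan_full_joined[OF p N1(1) k N1(2)] by metis
  obtain i' cB where B: "1 \<le> i'" "i' < ?m" "adj (last p) (rev p ! i')" "\<And>e. cB e < k"
    "\<And>x. x \<in> (!) (rev p) ` {0..i'} - {rev p ! i'} \<Longrightarrow> full_joined k cB ((!) (rev p) ` {0..i'}) x (rev p ! i')"
    using path_fan_full_joined[of "rev p" k] p N2 k by (simp add: hd_rev) metis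
  \<comment> \<open>The root of the second fan, counted from the front of \<open>p\<close>.\<close>
  define j where "j = ?m - 1 - i'"
  have j: "j < ?m - 1" "rev p ! i' = p ! j" using B by (auto simp: j_def rev_nth)
  define X where "X = (!) p ` {0..i}"
  define Y where "Y = (!) p ` {j..?m - 1}"
  have "(!) (rev p) ` {0..i'} = Y"
  proof -
    have "(!) (rev p) ` {0..i'} = (\<lambda>t. p ! (?m - 1 - t)) ` {0..i'}"
      using B by (intro image_cong) (auto simp: rev_nth)
    also have "\<dots> = (!) p ` ((\<lambda>t. ?m - 1 - t) ` {0..i'})" by (simp add: image_image)
    also have "(\<lambda>t. ?m - 1 - t) ` {0..i'} = {j..?m - 1}"
    proof (intro equalityI subsetI)
      fix t assume "t \<in> {j..?m - 1}"
      then show "t \<in> (\<lambda>t. ?m - 1 - t) ` {0..i'}" using B j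
        by (intro image_eqI[of _ _ "?m - 1 - t"]) (auto simp: j_def)
    qed (auto simp: j_def)
    finally show ?thesis by (simp add: Y_def)
  qed
  then have fullB: "full_joined k cB Y x (p ! j)" if "x \<in> Y - {p ! j}" for x
    using B(5) that j(2) by simp
  have fullA: "full_joined k cA X x (p ! i)" if "x \<in> X - {p ! i}" for x
    using A(5) that by (simp add: X_def)
  have ij: "i \<le> j" using nocross[of j i] A(2,3) B(3) j(2) by (metis not_le)
  have inj: "p ! s = p ! t \<longleftrightarrow> s = t" if "s < ?m" "t < ?m" for s t
    using is_path_nth(1)[OF p] that by (auto simp: inj_on_def)
  have XY: "X \<inter> Y \<subseteq> {p ! i}"
  proof
    fix x assume "x \<in> X \<inter> Y"
    then obtain s t where "x = p ! s" "s \<le> i" "x = p ! t" "j \<le> t" "t \<le> ?m - 1"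
      unfolding X_def Y_def by (elim IntE imageE) simp
    moreover then have "s = t" using inj[of s t] A(2) m by auto
    ultimately have "t = i" "x = p ! t" using ij by auto
    then show "x \<in> {p ! i}" by simp
  qed
  have pV: "p ! t \<in> V" if "t < ?m" for t using is_path_nth(4)[OF p] that by auto
  \<comment> \<open>No edge inside \<open>Y\<close> is a subset of \<open>X\<close>, so the first
    branch never disturbs the second fan.\<close>
  define c where "c e = (if e \<subseteq> X then cA e else cB e)" for e
  have ck: "c e < k" for e using A(4) B(4) by (simp add: c_def)
  have cX: "full_joined k c X x (p ! i)" if "x \<in> X - {p ! i}" for x
    using fullA[OF that] by (rule full_joined_recolor) (simp add: c_def)
  have cY: "full_joined k c Y x (p ! j)" if "x \<in> Y - {p ! j}" for x
  proof (rule full_joined_recolor[OF fullB[OF that]])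
    fix e assume e: "e \<subseteq> Y" "card e = 2"
    have "\<not> e \<subseteq> X"
    proof
      assume "e \<subseteq> X"
      then have "e \<subseteq> {p ! i}" using e XY by blast
      then show False using card_mono[of "{p ! i}" e] e(2) by simp
    qed
    then show "c e = cB e" by (simp add: c_def)
  qed
  have XV: "X \<subseteq> V" "p ! i \<in> X" "X \<noteq> {p ! i}"
  proof -
    show "X \<subseteq> V" using pV A(2) by (auto simp: X_def)
    show "p ! i \<in> X" by (simp add: X_def)
    have "p ! 0 \<in> X" "p ! 0 \<noteq> p ! i" using inj[of 0 i] A m by (auto simp: X_def)
    then show "X \<noteq> {p ! i}" by blast
  qed
  have YV: "Y \<subseteq> V" "p ! j \<in> Y" "Y \<noteq> {p ! j}"
  proof -
    show "Y \<subseteq> V" using pV by (auto simp: Y_def lm)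
    show "p ! j \<in> Y" using j by (simp add: Y_def)
    have "p ! (?m - 1) \<in> Y" "p ! (?m - 1) \<noteq> p ! j" using inj[of "?m - 1" j] j by (auto simp: Y_def)
    then show "Y \<noteq> {p ! j}" by blast
  qed
  have "full_joined k c V u v" if uv: "u \<in> V" "v \<in> V" "u \<noteq> v" for u v
  proof -
    have "p ! 0 \<in> set p" using m by simp
    then obtain b where b: "b \<in> set p" "joined (- (set p - {b})) u b"
      using joined_first_hit[of u "p ! 0" "set p"] connected_V[of u "p ! 0"] uv pV[OF m] by metis
    then obtain t where t: "t < ?m" "b = p ! t" by (metis in_set_conv_nth)
    have sub: "X \<subseteq> set p" "Y \<subseteq> set p" using A(2) by (auto simp: X_def Y_def lm)
    show ?thesis
    proof (cases "t \<le> j")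
      case True
      have "(!) p ` {t..j} \<inter> Y \<subseteq> {p ! j}"
      proof
        fix x assume "x \<in> (!) p ` {t..j} \<inter> Y"
        then obtain r s where "x = p ! r" "r \<in> {t..j}" "x = p ! s" "s \<in> {j..?m - 1}"
          unfolding Y_def by blast
        then show "x \<in> {p ! j}" using inj[of r s] j(1) by (auto simp: lm)
      qed
      then have **: "(!) p ` {t..j} \<subseteq> - (Y - {p ! j})" by blast
      then have "joined (- (Y - {p ! j})) (p ! t) (p ! j)"
        using joined_mono[OF joined_segment[OF p True]] j(1) by simp
      moreover have "joined (- (Y - {p ! j})) u (p ! t)"
      proof -
        have "p ! t \<in> - (Y - {p ! j})" by (rule subsetD[OF **], rule imageI) (use True in simp)
        then have "- (set p - {b}) \<subseteq> - (Y - {p ! j})" using sub t by auto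
        then show ?thesis using joined_mono b t by metis
      qed
      ultimately show ?thesis using rooted_full_joined[OF YV cY] joined_trans uv by blast
    next
      case False
      have "(!) p ` {i..t} \<inter> X \<subseteq> {p ! i}"
      proof
        fix x assume "x \<in> (!) p ` {i..t} \<inter> X"
        then obtain r s where "x = p ! r" "r \<in> {0..i}" "x = p ! s" "s \<in> {i..t}"
          unfolding X_def by blast
        then show "x \<in> {p ! i}" using inj[of r s] t(1) by auto
      qed
      then have *: "(!) p ` {i..t} \<subseteq> - (X - {p ! i})" by blast
      then have "joined (- (X - {p ! i})) (p ! i) (p ! t)"
        using joined_mono[OF joined_segment[OF p _ t(1)]] ij False by simp
      then have "joined (- (X - {p ! i})) (p ! t) (p ! i)" by (rule joined_sym)
      moreover have "joined (- (X - {p ! i})) u (p ! t)"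
      proof -
        have "p ! t \<in> - (X - {p ! i})" by (rule subsetD[OF *], rule imageI) (use False ij in simp)
        then have "- (set p - {b}) \<subseteq> - (X - {p ! i})" using sub t by auto
        then show ?thesis using joined_mono b t by metis
      qed
      ultimately show ?thesis using rooted_full_joined[OF XV cX] joined_trans uv by blast
    qed
  qed
  then show ?thesis using ck by blast
qed

text \<open>If some vertex were missed, connectedness would give a vertex off \<open>C\<close>
  adjacent to some \<open>b\<close> on \<open>C\<close>. Opening \<open>C\<close> at
  \<open>b\<close> and starting at that vertex gives a path that is too long.\<close>

lemma longest_cycle_spanning:
  assumes C: "is_cycle C" and longest: "\<And>q. is_path q \<Longrightarrow> length q \<le> length C"
  shows "set C = V"
proof (rule ccontr)
  assume "set C \<noteq> V"
  moreover have CV: "set C \<subseteq> V" "hd C \<in> set C" using C by (auto simp: is_cycle_def is_path_def)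
  ultimately obtain w where w: "w \<in> V" "w \<notin> set C" by blast
  have "joined V w (hd C)" using connected_V w CV by blast
  from joined_first_hit[OF this CV(2)] obtain b where b: "b \<in> set C" "joined (- (set C - {b})) w b" .
  then obtain r where r: "is_path r" "set r \<subseteq> - (set C - {b})" "hd r = w" "last r = b"
    unfolding joined_def by blast
  have "r \<noteq> []" using r by (simp add: is_path_def)
  then obtain r' where r': "r = r' @ [b]" using r(4) by (metis append_butlast_last_id)
  have ne: "r' \<noteq> []" using r r' w b by auto
  then have "adj (last r') b" "last r' \<noteq> b" "last r' \<in> V"
    using r(1) r' is_path_append[OF ne, of "[b]"] by (auto simp: is_path_def)
  moreover have "last r' \<notin> set C" using r(2) r' ne \<open>last r' \<noteq> b\<close> by (auto dest: last_in_set)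
  moreover obtain t where t: "t < length C" "b = cyc C t" using in_cycle[OF b(1)] by blast
  let ?q = "map (cyc C) [t..<Suc (t + length C - 1)]"
  have L: "length C > 0" using C by (auto simp: is_cycle_def)
  have q: "is_path ?q" by (rule cyc_path[OF C]; use L in linarith)
  have len: "length ?q = length C" using L by simp
  have "?q \<noteq> []" using len L by (metis length_greater_0_conv)
  moreover have "hd ?q = b" using t L by (simp add: hd_map del: upt_Suc)
  moreover have "set ?q \<subseteq> set C" using cyc_mem[OF C] by auto
  ultimately have "is_path (last r' # ?q)" using q is_path_Cons[of ?q "last r'"] by (metis subsetD)
  then show False using longest[of "last r' # ?q"] len by simp
qed

lemma spanning_cycle_full_joined:
  assumes C: "is_cycle C" "set C = V" and k: "2 \<le> k" and V: "4 \<le> card V"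
    and deg: "\<And>x. x \<in> V \<Longrightarrow> k \<le> card {y. adj x y}"
  shows "\<exists>c. (\<forall>e. c e < k) \<and> (\<forall>u \<in> V. \<forall>v \<in> V. u \<noteq> v \<longrightarrow> full_joined k c V u v)"
proof (cases "2 * k \<le> length C")
  case True
  have "1 \<le> k" using k by simp
  from long_cycle_full_joined[OF C(1) this True] show ?thesis unfolding C(2) by metis
next
  case False
  have d: "distinct C" "is_path C" using C(1) by (auto simp: is_cycle_def is_path_def)
  have len: "length C = card V" using d C(2) by (metis distinct_card)
  \<comment> \<open>Removing \<open>z\<close> leaves a path on \<open>card V - 1\<close> vertices
    whose vertices keep at least \<open>k - 1\<close> neighbors on it. From
    \<open>card V < 2 * k\<close> follows \<open>card V - 1 \<le> 2 * (k - 1)\<close>, the bound in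
    Dirac's count.\<close>
  then obtain z p where zp: "C = z # p" using V by (cases C) auto
  have "p \<noteq> []" using zp len V by auto
  then have p: "is_path p" using d zp is_path_Cons by blast
  have sp: "set p = V - {z}" "z \<in> V" "z \<notin> set p" using zp d C(2) by auto
  have lenp: "length p = card V - 1" using zp len by simp
  have deg': "k - 1 \<le> card {y \<in> set p. adj x y}" if "x \<in> set p" for x
  proof -
    have "{y. adj x y} - {z} \<subseteq> {y \<in> set p. adj x y}" using sp adj_V adj_sym by blast
    then have "card ({y. adj x y} - {z}) \<le> card {y \<in> set p. adj x y}" by (intro card_mono) auto
    moreover have "card {y. adj x y} - 1 \<le> card ({y. adj x y} - {z})"
      by (metis card_Diff_singleton_if diff_le_self order_refl)
    ultimately show ?thesis using deg[of x] that sp by force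
  qed
  obtain i where i: "Suc i < length p" "adj (p ! 0) (p ! Suc i)" "adj (last p) (p ! i)"
  proof (rule adjacent_crossing[of p "k - 1"])
    show "length p \<le> 2 * (k - 1)" using False lenp len by simp
    show "1 \<le> length p" using lenp V by simp
    show "k - 1 \<le> card {y \<in> set p. adj (p ! 0) y}" using deg'[of "p ! 0"] \<open>p \<noteq> []\<close> by simp
    show "k - 1 \<le> card {y \<in> set p. adj (last p) y}" using deg'[of "last p"] \<open>p \<noteq> []\<close> by simp
  qed (use p in blast)+
  let ?D = "take (Suc i) p @ rev (drop (Suc i) p)"
  have D: "is_cycle ?D" using i lenp V by (intro crossing_cycle[OF p]) auto
  have sD: "set ?D = V - {z}" using sp by (metis append_take_drop_id set_append set_rev)
  have nz: "{y \<in> set ?D. adj z y} = {y. adj z y}" unfolding sD using adj_V adj_sym adj_irrefl by blast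
  have "1 \<le> k" "k \<le> card {y \<in> set ?D. adj z y}" "z \<notin> set ?D" using k deg[OF sp(2)] sD nz by auto
  from wheel_full_joined[OF D sp(2) this(3,1,2)] obtain c where c: "\<forall>e. c e < k"
    "\<forall>x y. x \<in> insert z (set ?D) \<longrightarrow> y \<in> insert z (set ?D) \<longrightarrow> x \<noteq> y \<longrightarrow>
      full_joined k c (insert z (set ?D)) x y"
    by metis
  have "insert z (set ?D) = V" using sD sp(2) by auto
  then show ?thesis using c by (intro exI[of _ c]) simp
qed

lemma crossing_full_joined:
  assumes p: "is_path p" and k: "2 \<le> k" and V: "4 \<le> card V"
    and deg: "\<And>x. x \<in> V \<Longrightarrow> k \<le> card {y. adj x y}"
    and longest: "\<And>q. is_path q \<Longrightarrow> length q \<le> length p"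
    and N: "{y. adj (hd p) y} \<subseteq> set p" "{y. adj (last p) y} \<subseteq> set p"
    and ij: "i < j" "j < length p" "adj (hd p) (p ! j)" "adj (last p) (p ! i)"
  shows "\<exists>c. (\<forall>e. c e < k) \<and> (\<forall>u \<in> V. \<forall>v \<in> V. u \<noteq> v \<longrightarrow> full_joined k c V u v)"
proof -
  let ?m = "length p"
  have ne: "p \<noteq> []" using p by (simp add: is_path_def)
  have hd: "hd p = p ! 0" and last: "last p = p ! (?m - 1)" using ne by (auto simp: hd_conv_nth last_conv_nth)
  have hl: "hd p \<in> V" "last p \<in> V" using p ne by (auto simp: is_path_def)
  define cross where "cross i j \<longleftrightarrow> i < j \<and> j < ?m \<and> adj (hd p) (p ! j) \<and> adj (last p) (p ! i)" for i j
  show ?thesis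
  proof (cases "\<exists>i. cross i (Suc i)")
    case True
    then obtain i where i: "cross i (Suc i)" by blast
    have "k \<le> card (set p)" using deg[OF hl(1)] N(1) by (meson card_mono finite_set le_trans)
    have "card (insert (hd p) {y. adj (hd p) y}) \<le> card (set p)" using N(1) ne by (intro card_mono) auto
    moreover have "finite {y. adj (hd p) y}" using N(1) finite_subset by blast
    \<comment> \<open>The first vertex and at least two neighbors of it lie on \<open>p\<close>,
      enough to close a cycle.\<close>
    ultimately have "3 \<le> ?m" using deg[OF hl(1)] k adj_irrefl card_length[of p] by simp
    let ?C = "take (Suc i) p @ rev (drop (Suc i) p)"
    have C: "is_cycle ?C" using i \<open>3 \<le> ?m\<close> by (intro crossing_cycle[OF p]) (auto simp: cross_def hd)
    have "length ?C = ?m" by simp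
    then have "set ?C = V" using longest_cycle_spanning[OF C] longest by simp
    then show ?thesis using spanning_cycle_full_joined[OF C _ k V deg] by blast
  next
    case noadj: False
    \<comment> \<open>By minimality neither end of \<open>p\<close> has a neighbor strictly between
      \<open>i\<close> and \<open>j\<close>, since that would give a narrower crossing.\<close>
    obtain i j where ij: "cross i j" and min: "\<And>i' j'. cross i' j' \<Longrightarrow> j - i \<le> j' - i'"
    proof -
      obtain d where "d \<in> (\<lambda>(i, j). j - i) ` {(i, j). cross i j}"
        "\<And>d'. d' \<in> (\<lambda>(i, j). j - i) ` {(i, j). cross i j} \<Longrightarrow> d \<le> d'"
        using assms(8-11) exists_least_iff[of "\<lambda>d. d \<in> (\<lambda>(i, j). j - i) ` {(i, j). cross i j}"]
        unfolding cross_def by (metis (mono_tags, lifting) case_prodI image_eqI mem_Collect_eq not_le)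
      then show ?thesis using that by force
    qed
    have ij': "i < j" "j < ?m" using ij by (auto simp: cross_def)
    define N1 where "N1 = {t. t < ?m \<and> adj (hd p) (p ! t)}"
    define N2 where "N2 = {t. t < ?m \<and> adj (last p) (p ! t)}"
    have "{y \<in> set p. adj (hd p) y} = {y. adj (hd p) y}" "{y \<in> set p. adj (last p) y} = {y. adj (last p) y}"
      using N by blast+
    then have cN: "k \<le> card N1" "k \<le> card N2"
      using card_neighbour_indices[OF p] deg hl by (simp_all add: N1_def N2_def)
    have fin: "finite N1" "finite N2" by (auto simp: N1_def N2_def)
    have pos: "0 < t" if "t \<in> N1" for t using that adj_irrefl hd by (auto simp: N1_def intro: gr0I)
    have lt: "t < ?m - 1" if "t \<in> N2" for t
    proof -
      have "t < ?m" "t \<noteq> ?m - 1" using that adj_irrefl last by (auto simp: N2_def)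
      then show ?thesis by simp
    qed
    \<comment> \<open>The index \<open>j\<close> is left out because its shift \<open>j - 1\<close>
      falls into the gap. The other shifted indices stay outside the gap, and a common element with
      \<open>N2\<close> would be a crossing of width one.\<close>
    define T where "T = (\<lambda>t. t - 1) ` (N1 - {j})"
    have disj: "T \<inter> N2 = {}"
    proof (rule ccontr)
      assume "T \<inter> N2 \<noteq> {}"
      then obtain t where "t \<in> N1" "t - 1 \<in> N2" by (auto simp: T_def)
      then have "cross (t - 1) (Suc (t - 1))" using pos[of t] by (auto simp: cross_def N1_def N2_def)
      then show False using noadj by blast
    qed
    have N2ij: "t \<le> i \<or> j \<le> t" if "t \<in> N2" for t
    proof (rule ccontr)
      assume no: "\<not> ?thesis"
      then have "cross t j" using ij that by (auto simp: cross_def N2_def)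
      then show False using min[of t j] no ij' by auto
    qed
    have N1ij: "t \<le> i \<or> j \<le> t" if "t \<in> N1" for t
    proof (rule ccontr)
      assume no: "\<not> ?thesis"
      then have "cross i t" using ij that by (auto simp: cross_def N1_def)
      then show False using min[of i t] no ij' by auto
    qed
    have "T \<union> N2 \<subseteq> {0..i} \<union> {j..<?m - 1}"
    proof (intro Un_least subsetI)
      fix s assume "s \<in> T"
      then obtain t where t: "s = t - 1" "t \<in> N1" "t \<noteq> j" by (auto simp: T_def)
      then have "t < ?m" by (simp add: N1_def)
      then show "s \<in> {0..i} \<union> {j..<?m - 1}" using N1ij[OF t(2)] t(1,3) pos[OF t(2)] by auto
    next
      fix s assume "s \<in> N2"
      then show "s \<in> {0..i} \<union> {j..<?m - 1}" using N2ij lt by auto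
    qed
    then have "card (T \<union> N2) \<le> card ({0..i} \<union> {j..<?m - 1})" by (intro card_mono) auto
    also have "\<dots> = Suc i + (?m - 1 - j)" using ij' by (subst card_Un_disjoint) auto
    also have "card (T \<union> N2) = card T + card N2" using disj fin by (intro card_Un_disjoint) (auto simp: T_def)
    also have "card T = card (N1 - {j})" unfolding T_def
      using pos by (intro card_image inj_onI) (metis DiffD1 One_nat_def Suc_pred)
    also have "card (N1 - {j}) = card N1 - 1" using ij by (simp add: cross_def N1_def)
    \<comment> \<open>Omitting \<open>j\<close> costs one on the left; on the right the position
      \<open>?m - 1\<close> is excluded, as no vertex is its own neighbor. The two losses cancel,
      and the right-hand side is the length of the cycle.\<close>
    finally have len: "2 * k \<le> Suc i + (?m - j)" using cN k ij' by linarith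
    let ?C = "take (Suc i) p @ rev (drop j p)"
    have C: "is_cycle ?C" using ij len k by (intro crossing_cycle[OF p]) (auto simp: cross_def hd)
    have lC: "2 * k \<le> length ?C" using len ij' by simp
    have "1 \<le> k" using k by simp
    from long_cycle_full_joined[OF C this lC] obtain c where c: "\<forall>e. c e < k"
      "\<forall>x y. x \<in> set ?C \<longrightarrow> y \<in> set ?C \<longrightarrow> x \<noteq> y \<longrightarrow> full_joined k c (set ?C) x y" by metis
    have CV: "set ?C \<subseteq> V" using C by (simp add: is_cycle_def is_path_def)
    have hC: "hd ?C \<in> set ?C" by (rule hd_in_set) (use ij' ne in auto)
    have "distinct ?C" using C by (simp add: is_cycle_def is_path_def)
    then have "card (set ?C) \<ge> 3" using lC C by (metis distinct_card is_cycle_def)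
    then have "set ?C \<noteq> {hd ?C}" by (metis card.empty card_insert_disjoint empty_iff finite.emptyI
        Suc_le_mono not_less_eq_eq numeral_3_eq_3 zero_le)
    then have "\<forall>u \<in> V. \<forall>v \<in> V. u \<noteq> v \<longrightarrow> full_joined k c V u v"
      using clique_full_joined[OF CV hC] c(2) by blast
    then show ?thesis using c(1) by blast
  qed
qed

theorem exists_full_coloring:
  assumes k: "2 \<le> k" and V: "4 \<le> card V" and deg: "\<And>x. x \<in> V \<Longrightarrow> k \<le> card {y. adj x y}"
  shows "\<exists>c. (\<forall>e. c e < k) \<and> (\<forall>u \<in> V. \<forall>v \<in> V. u \<noteq> v \<longrightarrow> full_joined k c V u v)"
proof -
  obtain x where "x \<in> V" using V by fastforce
  then have "is_path [x]" by (simp add: is_path_def)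
  moreover have "\<forall>q. is_path q \<longrightarrow> length q < Suc (card V)"
    unfolding is_path_def using finite_V by (metis card_mono distinct_card le_imp_less_Suc)
  ultimately obtain p where p: "is_path p" "\<And>q. is_path q \<Longrightarrow> length q \<le> length p"
    using ex_has_greatest_nat[of is_path "[x]" length "Suc (card V)"] by metis
  \<comment> \<open>A neighbor off \<open>q\<close> could be put in front of it. Allowing every path
    of maximal length covers the other end through \<open>rev p\<close>.\<close>
  have max: "{y. adj (hd q) y} \<subseteq> set q" if "is_path q" "length q = length p" for q
  proof (rule ccontr)
    assume "\<not> ?thesis"
    then obtain y where "adj (hd q) y" "y \<notin> set q" by blast
    moreover have "q \<noteq> []" using that by (simp add: is_path_def)
    ultimately have "is_path (y # q)" using that adj_sym by (simp add: is_path_Cons)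
    then show False using p(2)[of "y # q"] that by simp
  qed
  have N: "{y. adj (hd p) y} \<subseteq> set p" "{y. adj (last p) y} \<subseteq> set p"
    using max[of p] max[of "rev p"] p(1) by (simp_all add: hd_rev)
  have "hd p \<in> V" "last p \<in> V" using p(1) by (auto simp: is_path_def)
  then have d: "k \<le> card {y. adj (hd p) y}" "k \<le> card {y. adj (last p) y}" using deg by blast+
  show ?thesis
  proof (cases "\<exists>i j. i < j \<and> j < length p \<and> adj (hd p) (p ! j) \<and> adj (last p) (p ! i)")
    case True
    then show ?thesis using crossing_full_joined[OF p(1) k V deg p(2) N] by blast
  next
    case False
    have "1 \<le> k" using k by simp
    show ?thesis
      by (rule two_fans_full_joined[OF p(1) \<open>1 \<le> k\<close> N(1) d(1) N(2) d(2)]) (use False in blast)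
  qed
qed

end

section \<open>Transfer to pair graphs\<close>

lemma pair_graph_adj_sym: "pair_graph G \<Longrightarrow> (x, y) \<in> parcs G \<Longrightarrow> (y, x) \<in> parcs G"
proof -
  assume "pair_graph G" "(x, y) \<in> parcs G"
  then interpret pair_graph G by simp
  show ?thesis using pair_sym_arcs \<open>(x, y) \<in> parcs G\<close> by (auto simp: symmetric_def sym_def)
qed

lemma simple_graph_of_pair_graph:
  assumes "pair_graph G"
  shows "simple_graph (pverts G) (\<lambda>x y. (x, y) \<in> parcs G)"
proof -
  interpret pair_graph G by fact
  show ?thesis
  proof
    show "finite (pverts G)" by (rule pair_finite_verts)
  next
    fix x y assume "(x, y) \<in> parcs G"
    then show "(y, x) \<in> parcs G" by (rule pair_graph_adj_sym[OF assms])
  next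
    fix x show "(x, x) \<notin> parcs G" using pair_no_loops[of "(x, x)"] by auto
  next
    fix x y assume "(x, y) \<in> parcs G"
    then show "x \<in> pverts G" by (rule in_arcsD1)
  qed
qed

text \<open>Deleting the single vertex \<open>w\<close> leaves a connected graph, and its
  reachability relation is turned into paths step by step.\<close>

lemma biconnected_graph_of_pair_graph:
  assumes G: "pair_graph G" and "vertex_connected 2 G"
  shows "biconnected_graph (pverts G) (\<lambda>x y. (x, y) \<in> parcs G)"
proof -
  interpret pair_graph G by fact
  interpret S: simple_graph "pverts G" "\<lambda>x y. (x, y) \<in> parcs G"
    by (rule simple_graph_of_pair_graph[OF G])
  show ?thesis
  proof
    show "3 \<le> card (pverts G)" using assms(2) by (simp add: vertex_connected_def)
  next
    fix w x y assume w: "w \<in> pverts G" and xy: "x \<in> pverts G - {w}" "y \<in> pverts G - {w}"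
    let ?H = "with_proj G \<restriction> (pverts G - {w})"
    have "connected ?H" using assms(2) w by (simp add: vertex_connected_def)
    then have "(x, y) \<in> rtrancl_on (pverts G - {w}) ((arcs_ends ?H)\<^sup>s)"
      using xy by (simp add: connected_conv)
    then show "S.joined (- {w}) x y"
    proof (induction rule: rtrancl_on.induct)
      case (rtrancl_on_refl a)
      then show ?case by (intro S.joined_refl) auto
    next
      \<comment> \<open>The induction appends a vertex at the end while \<open>joined_step\<close>
        prepends one, hence the two reversals.\<close>
      case (rtrancl_on_into_rtrancl_on a b d)
      have "(d, b) \<in> parcs G"
        using rtrancl_on_into_rtrancl_on.hyps(2) S.adj_sym
        by (auto simp: symcl_def arcs_ends_def arc_to_ends_def induce_subgraph_def)
      then have "S.joined (- {w}) d a"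
        using S.joined_step[of d b "- {w}" a] S.joined_sym rtrancl_on_into_rtrancl_on by auto
      then show ?case by (rule S.joined_sym)
    qed
  qed
qed

lemma min_degree_le:
  assumes "pair_graph G" "x \<in> pverts G"
  shows "min_degree G \<le> card {y. (x, y) \<in> parcs G}"
proof -
  interpret pair_graph G by fact
  have "out_arcs (with_proj G) x = Pair x ` {y. (x, y) \<in> parcs G}" by (auto simp: out_arcs_def)
  then have "out_degree (with_proj G) x = card {y. (x, y) \<in> parcs G}"
    by (simp add: out_degree_def card_image inj_on_def)
  moreover have "min_degree G \<le> out_degree (with_proj G) x"
    unfolding min_degree_def using assms(2) pair_finite_verts by (intro Min_le) auto
  ultimately show ?thesis by simp
qed

text \<open>A path between any two distinct vertices already shows \<open>k\<close> colors, all of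
  them on edges of \<open>G\<close>.\<close>

lemma color_connecting_lower_bound:
  assumes "pair_graph G" "2 \<le> card (pverts G)" "color_connecting k G c"
  shows "k \<le> card (c ` uedges G)"
proof -
  interpret pair_graph G by fact
  obtain u v where "u \<in> pverts G" "v \<in> pverts G" "u \<noteq> v"
    using assms(2) by (metis card_le_Suc0_iff_eq pair_finite_verts not_less_eq_eq numeral_2_eq_2)
  then obtain p where p: "vpath p (with_proj G)" "k \<le> card (path_colors c p)"
    using assms(3) unfolding color_connecting_def by blast
  have "set (vwalk_arcs p) \<subseteq> parcs G" using p(1) by (auto simp: vpath_def vwalk_def)
  then have "path_colors c p \<subseteq> c ` uedges G" by (auto simp: path_colors_def uedges_def)
  moreover have "uedges G = (\<lambda>(u, v). {u, v}) ` parcs G" by (auto simp: uedges_def)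
  then have "finite (uedges G)" using pair_finite_arcs by simp
  ultimately show ?thesis using p(2) card_mono by (meson finite_imageI le_trans)
qed

lemma (in simple_graph) color_connecting_if_full_joined:
  assumes V: "V = pverts G" and adj: "adj = (\<lambda>x y. (x, y) \<in> parcs G)"
    and full: "\<And>u v. u \<in> V \<Longrightarrow> v \<in> V \<Longrightarrow> u \<noteq> v \<Longrightarrow> full_joined k c V u v"
  shows "color_connecting k G c"
  unfolding color_connecting_def
proof (intro ballI impI)
  fix u v assume "u \<in> pverts G" "v \<in> pverts G" "u \<noteq> v"
  then obtain p where p: "is_path p" "hd p = u" "last p = v" "{..<k} \<subseteq> c ` ledges p"
    using full[of u v] V unfolding full_joined_def by blast
  have "vpath p (with_proj G)"
    using p(1)[unfolded is_path_def] V adj by (simp add: vpath_def vwalk_def vwalk_arcs_successively)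
  moreover have "k \<le> card (path_colors c p)"
    using card_mono[OF _ p(4)] by (simp add: path_colors_ledges)
  ultimately show "\<exists>p. vpath p (with_proj G) \<and> hd p = u \<and> last p = v \<and> k \<le> card (path_colors c p)"
    using p by blast
qed

lemma cc_eqI:
  assumes "color_connecting k G c" "card (c ` uedges G) \<le> k"
    and "\<And>c. color_connecting k G c \<Longrightarrow> k \<le> card (c ` uedges G)"
  shows "cc k G = enat k"
  unfolding cc_def
proof (rule antisym)
  show "(INF c \<in> {c. color_connecting k G c}. enat (card (c ` uedges G))) \<le> enat k"
    using assms(1,2) by (intro INF_lower2[of c]) auto
  show "enat k \<le> (INF c \<in> {c. color_connecting k G c}. enat (card (c ` uedges G)))"
    using assms(3) by (intro INF_greatest) auto
qed

theorem theorem3p4: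
  fixes G :: "'a pair_pre_digraph" and k n :: nat
  assumes "k \<ge> 2"
    and "pair_graph G"
    and "vertex_connected 2 G"
    and "card (pverts G) = n" and "n \<ge> 4"
    and "min_degree G \<ge> k"
  shows "cc k G = enat k"
proof -
  interpret biconnected_graph "pverts G" "\<lambda>x y. (x, y) \<in> parcs G"
    by (rule biconnected_graph_of_pair_graph[OF assms(2,3)])
  have deg: "k \<le> card {y. (x, y) \<in> parcs G}" if "x \<in> pverts G" for x
    using min_degree_le[OF assms(2) that] assms(6) by linarith
  have "4 \<le> card (pverts G)" using assms(4,5) by simp
  from exists_full_coloring[OF assms(1) this deg] obtain c where c: "\<forall>e. c e < k"
    "\<forall>u \<in> pverts G. \<forall>v \<in> pverts G. u \<noteq> v \<longrightarrow> full_joined k c (pverts G) u v" by blast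
  show ?thesis
  proof (rule cc_eqI)
    show "color_connecting k G c"
      using c(2) by (intro color_connecting_if_full_joined) auto
    have "card (c ` uedges G) \<le> card {..<k}" using c(1) by (intro card_mono) auto
    then show "card (c ` uedges G) \<le> k" by simp
  qed (use color_connecting_lower_bound[OF assms(2)] assms(4,5) in auto)
qed

end
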